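(* Let $(M_1^{2m},g_1)$, $m\geq 1$, be a Riemannian spin manifold admitting a Killing spinor $\psi_1$ with $D_1\psi_1=\lambda_1\psi_1$, $\lambda_1\neq 0\in\mathbb{R}$. Let $(\overline{M}_2^{\,r},\overline{g}_2)$, $2m>r\geq 2$, be a Riemannian spin manifold admitting a parallel spinor $\psi_2$. Let $(S^1,g_S)$ be a circle with the standard metric. Then the Riemannian product manifold $(M_1^{2m}\times\overline{M}_2^{\,r},\,g_1+\overline{g}_2)$, as well as $(M_1^{2m}\times S^1,\,g_1+g_S)$, admits a non-trivial eigenspinor $\psi^{\ast}$ of its Dirac operator $D$ such that, with $n_1=2m$, $$\nabla_X\psi^{\ast}=-\frac{\lambda^{\ast}}{2n_1}\,X\cdot\psi^{\ast}-\frac{\lambda^{\ast}}{2n_1}\,\phi(X)\cdot\psi^{\ast}$$ holds for some real number $\lambda^{\ast}\neq 0$ and for all vector fields $X$.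
   Context: Manifolds are smooth, oriented and without boundary. "$\cdot$" is Clifford multiplication with $X\cdot Y+Y\cdot X=-2g(X,Y)$, and $\nabla$ denotes the spin derivative induced by the Levi-Civita connection. $D_1$ is the Dirac operator of $(M_1,g_1)$. A Killing spinor $\psi_1$ on $(M_1,g_1)$ with $D_1\psi_1=\lambda_1\psi_1$ is a non-trivial spinor field satisfying $\nabla^1_X\psi_1=-\frac{\lambda_1}{\dim M_1}X\cdot\psi_1$ for all vector fields $X$ on $M_1$; a parallel spinor is a non-trivial spinor field $\psi_2$ with $\nabla\psi_2=0$. Each product carries the naturally induced product spin structure; for $M_1\times S^1$ this is the spin structure pulled back from $M_1$ (equivalently, $S^1$ carries the spin structure admitting parallel spinors), so that spinor fields on $M_1$ lift to $M_1\times S^1$. On each product, the product structure $\phi$ is the parallel $(1,1)$-tensor field equal to the identity on vectors tangent to $M_1$ and to minus the identity on vectors tangent to the second factor. With a local orthonormal frame $(E_i)$ of the product, $D\psi=\sum_i E_i\cdot\nabla_{E_i}\psi$. *)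

theory Defs
  imports "HOL-Analysis.Analysis"
begin

section \<open>Smooth maps\<close>

text \<open>Meant for open sets \<open>S\<close>: all derivatives of order at most \<open>k\<close> exist and are continuous.\<close>

primrec C_on :: "nat \<Rightarrow> ('a::real_normed_vector \<Rightarrow> 'b::real_normed_vector) \<Rightarrow> 'a set \<Rightarrow> bool" where
  "C_on 0 f S \<longleftrightarrow> continuous_on S f"
| "C_on (Suc k) f S \<longleftrightarrow> (\<forall>x\<in>S. f differentiable (at x)) \<and>
     (\<forall>v. C_on k (\<lambda>x. frechet_derivative f (at x) v) S)"

definition smooth_on :: "('a::real_normed_vector \<Rightarrow> 'b::real_normed_vector) \<Rightarrow> 'a set \<Rightarrow> bool" where
  "smooth_on f S \<longleftrightarrow> (\<forall>k. C_on k f S)"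

section \<open>Smooth manifolds\<close>

text \<open>
  A manifold is given by a topology and an indexed atlas \<open>chart i\<close> on \<open>chart_dom i\<close> with values in
  the model space \<open>'a\<close>; its dimension is \<open>DIM('a)\<close>. A tangent vector at \<open>p\<close> is represented, for
  each chart around \<open>p\<close>, by its coordinate vector in \<open>'a\<close>.
\<close>

record ('p, 'i, 'a) atlas =
  mtop :: "'p topology"
  index :: "'i set"
  chart_dom :: "'i \<Rightarrow> 'p set"
  chart :: "'i \<Rightarrow> 'p \<Rightarrow> 'a"

definition in_chart :: "('p, 'i, 'a, 'z) atlas_scheme \<Rightarrow> 'i \<Rightarrow> ('p \<Rightarrow> 'b) \<Rightarrow> 'a \<Rightarrow> 'b" where
  "in_chart M i f = (\<lambda>x. f (inv_into (chart_dom M i) (chart M i) x))"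

definition smooth_in_chart ::
    "('p, 'i, 'a::euclidean_space, 'z) atlas_scheme \<Rightarrow> 'i \<Rightarrow> 'p set \<Rightarrow> ('p \<Rightarrow> 'b::real_normed_vector) \<Rightarrow> bool" where
  "smooth_in_chart M i S f \<longleftrightarrow> smooth_on (in_chart M i f) (chart M i ` S)"

text \<open>The derivative of \<open>f\<close> at \<open>p\<close> along the tangent vector with coordinates \<open>v\<close> in the chart \<open>i\<close>.\<close>

definition chart_deriv ::
    "('p, 'i, 'a::euclidean_space, 'z) atlas_scheme \<Rightarrow> 'i \<Rightarrow> ('p \<Rightarrow> 'b::real_normed_vector) \<Rightarrow> 'p \<Rightarrow> 'a \<Rightarrow> 'b" where
  "chart_deriv M i f p v = frechet_derivative (in_chart M i f) (at (chart M i p)) v"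

text \<open>The coordinates in the chart \<open>j\<close> of the tangent vector with coordinates \<open>v\<close> in the chart \<open>i\<close>.\<close>

definition change_coords ::
    "('p, 'i, 'a::euclidean_space, 'z) atlas_scheme \<Rightarrow> 'i \<Rightarrow> 'i \<Rightarrow> 'p \<Rightarrow> 'a \<Rightarrow> 'a" where
  "change_coords M i j p v = chart_deriv M i (chart M j) p v"

definition smooth_manifold :: "('p, 'i, 'a::euclidean_space, 'z) atlas_scheme \<Rightarrow> bool" where
  "smooth_manifold M \<longleftrightarrow>
     Hausdorff_space (mtop M) \<and> second_countable (mtop M) \<and>
     (\<Union>i\<in>index M. chart_dom M i) = topspace (mtop M) \<and>
     (\<forall>i\<in>index M. openin (mtop M) (chart_dom M i) \<and> open (chart M i ` chart_dom M i) \<and>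
        homeomorphic_map (subtopology (mtop M) (chart_dom M i))
          (top_of_set (chart M i ` chart_dom M i)) (chart M i)) \<and>
     (\<forall>i\<in>index M. \<forall>j\<in>index M.
        smooth_in_chart M i (chart_dom M i \<inter> chart_dom M j) (chart M j))"

text \<open>A vector field is the family \<open>X i\<close> of its coordinate expressions.\<close>

definition vector_field ::
    "('p, 'i, 'a::euclidean_space, 'z) atlas_scheme \<Rightarrow> ('i \<Rightarrow> 'p \<Rightarrow> 'a) \<Rightarrow> bool" where
  "vector_field M X \<longleftrightarrow>
     (\<forall>i\<in>index M. smooth_in_chart M i (chart_dom M i) (X i)) \<and>
     (\<forall>i\<in>index M. \<forall>j\<in>index M. \<forall>p\<in>chart_dom M i \<inter> chart_dom M j.
        X j p = change_coords M i j p (X i p))"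

section \<open>Riemannian manifolds\<close>

record ('p, 'i, 'a) riemannian = "('p, 'i, 'a) atlas" +
  metric :: "'i \<Rightarrow> 'p \<Rightarrow> 'a \<Rightarrow> 'a \<Rightarrow> real"

definition riemannian_manifold :: "('p, 'i, 'a::euclidean_space, 'z) riemannian_scheme \<Rightarrow> bool" where
  "riemannian_manifold M \<longleftrightarrow> smooth_manifold M \<and>
     (\<forall>i\<in>index M. \<forall>p\<in>chart_dom M i. bilinear (metric M i p) \<and>
        (\<forall>v w. metric M i p v w = metric M i p w v) \<and>
        (\<forall>v. v \<noteq> 0 \<longrightarrow> metric M i p v v > 0)) \<and>
     (\<forall>i\<in>index M. \<forall>v w. smooth_in_chart M i (chart_dom M i) (\<lambda>p. metric M i p v w)) \<and>
     (\<forall>i\<in>index M. \<forall>j\<in>index M. \<forall>p\<in>chart_dom M i \<inter> chart_dom M j. \<forall>v w.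
        metric M j p (change_coords M i j p v) (change_coords M i j p w) = metric M i p v w)"

text \<open>
  The Levi-Civita connection in the chart \<open>i\<close>: \<open>christoffel M i p u v\<close> is the covariant derivative at
  \<open>p\<close>, in the direction \<open>u\<close>, of the vector field with constant coordinates \<open>v\<close>. It is
  determined as the unique torsion-free metric connection.
\<close>

definition christoffel ::
    "('p, 'i, 'a::euclidean_space, 'z) riemannian_scheme \<Rightarrow> 'i \<Rightarrow> 'p \<Rightarrow> 'a \<Rightarrow> 'a \<Rightarrow> 'a" where
  "christoffel M i p = (THE \<Gamma>. bilinear \<Gamma> \<and> (\<forall>u v. \<Gamma> u v = \<Gamma> v u) \<and>
     (\<forall>u v w. chart_deriv M i (\<lambda>q. metric M i q v w) p u =
        metric M i p (\<Gamma> u v) w + metric M i p v (\<Gamma> u w)))"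

definition levi_civita ::
    "('p, 'i, 'a::euclidean_space, 'z) riemannian_scheme \<Rightarrow> 'i \<Rightarrow> ('p \<Rightarrow> 'a) \<Rightarrow> 'p \<Rightarrow> 'a \<Rightarrow> 'a" where
  "levi_civita M i Y p u = chart_deriv M i Y p u + christoffel M i p u (Y p)"

section \<open>Spinor modules\<close>

text \<open>
  A complex module of dimension \<open>2 ^ (DIM('a) div 2)\<close> over the Clifford algebra of \<open>'a\<close> with
  \<open>v \<cdot> w + w \<cdot> v = - 2 (v \<bullet> w)\<close>, i.e. a space of Dirac spinors. In odd dimension both inequivalent
  modules are admitted.
\<close>

definition spinor_module :: "('a::euclidean_space \<Rightarrow> complex^'s::finite^'s) \<Rightarrow> bool" where
  "spinor_module c \<longleftrightarrow> CARD('s) = 2 ^ (DIM('a) div 2) \<and> linear c \<and>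
     (\<forall>v w. c v ** c w + c w ** c v = mat (complex_of_real (- 2 * (v \<bullet> w))))"

text \<open>
  The spin group consists of the products of an even number of unit vectors in the Clifford algebra.
  It acts faithfully on Dirac spinors and is identified with its image there.
\<close>

definition spin_group :: "('a::euclidean_space \<Rightarrow> complex^'s::finite^'s) \<Rightarrow> (complex^'s^'s) set" where
  "spin_group c = {foldr (\<lambda>v A. c v ** A) vs (mat 1) | vs.
     even (length vs) \<and> (\<forall>v\<in>set vs. norm v = 1)}"

section \<open>Riemannian spin manifolds\<close>

text \<open>
  \<open>frame i p\<close> is the orthonormal frame over \<open>chart_dom i\<close>, as an isometry from \<open>'a\<close> to the tangent
  space at \<open>p\<close> in the coordinates of the chart \<open>i\<close>. The spin structure is the cocycle
  \<open>spin_trans i j\<close> lifting the transition functions of these frames to the spin group. Asking for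
  a frame and a lift over each chart domain is no restriction, since the atlas can be refined.
  The frames define the orientation: a lift exists only if the transition functions take values
  in the special orthogonal group.
\<close>

record ('p, 'i, 'a, 's) spin = "('p, 'i, 'a) riemannian" +
  frame :: "'i \<Rightarrow> 'p \<Rightarrow> 'a \<Rightarrow> 'a"
  spin_trans :: "'i \<Rightarrow> 'i \<Rightarrow> 'p \<Rightarrow> complex^'s^'s"
  cliff :: "'a \<Rightarrow> complex^'s^'s"

definition spin_manifold :: "('p, 'i, 'a::euclidean_space, 's::finite) spin \<Rightarrow> bool" where
  "spin_manifold M \<longleftrightarrow> riemannian_manifold M \<and> spinor_module (cliff M) \<and>
     (\<forall>i\<in>index M. \<forall>p\<in>chart_dom M i. linear (frame M i p) \<and>
        (\<forall>v w. metric M i p (frame M i p v) (frame M i p w) = v \<bullet> w)) \<and>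
     (\<forall>i\<in>index M. \<forall>v. smooth_in_chart M i (chart_dom M i) (\<lambda>p. frame M i p v)) \<and>
     (\<forall>i\<in>index M. \<forall>j\<in>index M.
        smooth_in_chart M i (chart_dom M i \<inter> chart_dom M j) (spin_trans M i j) \<and>
        (\<forall>p\<in>chart_dom M i \<inter> chart_dom M j. spin_trans M i j p \<in> spin_group (cliff M) \<and>
           (\<forall>v w. change_coords M j i p (frame M j p v) = frame M i p w \<longrightarrow>
              spin_trans M i j p ** cliff M v = cliff M w ** spin_trans M i j p))) \<and>
     (\<forall>i\<in>index M. \<forall>j\<in>index M. \<forall>k\<in>index M.
        \<forall>p\<in>chart_dom M i \<inter> chart_dom M j \<inter> chart_dom M k.
          spin_trans M i j p ** spin_trans M j k p = spin_trans M i k p)"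

text \<open>
  A spinor field is a smooth section of the associated bundle of Dirac spinors, given by its
  components \<open>\<psi> i\<close> with respect to the frames.
\<close>

definition spinor_field :: "('p, 'i, 'a::euclidean_space, 's::finite) spin \<Rightarrow> ('i \<Rightarrow> 'p \<Rightarrow> complex^'s) \<Rightarrow> bool" where
  "spinor_field M \<psi> \<longleftrightarrow>
     (\<forall>i\<in>index M. smooth_in_chart M i (chart_dom M i) (\<psi> i)) \<and>
     (\<forall>i\<in>index M. \<forall>j\<in>index M. \<forall>p\<in>chart_dom M i \<inter> chart_dom M j.
        \<psi> i p = spin_trans M i j p *v \<psi> j p)"

definition nontrivial_spinor :: "('p, 'i, 'a::euclidean_space, 's::finite) spin \<Rightarrow> ('i \<Rightarrow> 'p \<Rightarrow> complex^'s) \<Rightarrow> bool" where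
  "nontrivial_spinor M \<psi> \<longleftrightarrow> (\<exists>i\<in>index M. \<exists>p\<in>chart_dom M i. \<psi> i p \<noteq> 0)"

text \<open>Clifford multiplication by the tangent vector at \<open>p\<close> with coordinates \<open>v\<close> in the chart \<open>i\<close>.\<close>

definition clifford_mult ::
    "('p, 'i, 'a::euclidean_space, 's::finite) spin \<Rightarrow> 'i \<Rightarrow> 'p \<Rightarrow> 'a \<Rightarrow> complex^'s \<Rightarrow> complex^'s" where
  "clifford_mult M i p v s = cliff M (\<Sum>b\<in>Basis. metric M i p v (frame M i p b) *\<^sub>R b) *v s"

text \<open>
  The local formula for the spin derivative induced by the Levi-Civita connection: in terms of
  a local orthonormal frame \<open>E\<close>, the derivative of \<open>\<psi>\<close> along \<open>v\<close> is the componentwise derivative plus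
  one quarter of the sum over \<open>a\<close>, \<open>b\<close> of \<open>g(\<nabla>\<^sub>v E\<^sub>a, E\<^sub>b) E\<^sub>a \<cdot> E\<^sub>b \<cdot> \<psi>\<close>.
\<close>

definition spin_deriv ::
    "('p, 'i, 'a::euclidean_space, 's::finite) spin \<Rightarrow> ('i \<Rightarrow> 'p \<Rightarrow> complex^'s) \<Rightarrow> 'i \<Rightarrow> 'p \<Rightarrow> 'a \<Rightarrow> complex^'s" where
  "spin_deriv M \<psi> i p v = chart_deriv M i (\<psi> i) p v + (1/4) *\<^sub>R (\<Sum>a\<in>Basis. \<Sum>b\<in>Basis.
     metric M i p (levi_civita M i (\<lambda>q. frame M i q a) p v) (frame M i p b) *\<^sub>R
       (cliff M a *v (cliff M b *v \<psi> i p)))"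

definition dirac ::
    "('p, 'i, 'a::euclidean_space, 's::finite) spin \<Rightarrow> ('i \<Rightarrow> 'p \<Rightarrow> complex^'s) \<Rightarrow> 'i \<Rightarrow> 'p \<Rightarrow> complex^'s" where
  "dirac M \<psi> i p = (\<Sum>b\<in>Basis. clifford_mult M i p (frame M i p b) (spin_deriv M \<psi> i p (frame M i p b)))"

definition eigenspinor ::
    "('p, 'i, 'a::euclidean_space, 's::finite) spin \<Rightarrow> real \<Rightarrow> ('i \<Rightarrow> 'p \<Rightarrow> complex^'s) \<Rightarrow> bool" where
  "eigenspinor M \<mu> \<psi> \<longleftrightarrow> spinor_field M \<psi> \<and> nontrivial_spinor M \<psi> \<and>
     (\<forall>i\<in>index M. \<forall>p\<in>chart_dom M i. dirac M \<psi> i p = \<mu> *\<^sub>R \<psi> i p)"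

definition killing_spinor ::
    "('p, 'i, 'a::euclidean_space, 's::finite) spin \<Rightarrow> real \<Rightarrow> ('i \<Rightarrow> 'p \<Rightarrow> complex^'s) \<Rightarrow> bool" where
  "killing_spinor M \<mu> \<psi> \<longleftrightarrow> eigenspinor M \<mu> \<psi> \<and>
     (\<forall>X. vector_field M X \<longrightarrow> (\<forall>i\<in>index M. \<forall>p\<in>chart_dom M i.
        spin_deriv M \<psi> i p (X i p) =
          - (\<mu> / real DIM('a)) *\<^sub>R clifford_mult M i p (X i p) (\<psi> i p)))"

definition parallel_spinor ::
    "('p, 'i, 'a::euclidean_space, 's::finite) spin \<Rightarrow> ('i \<Rightarrow> 'p \<Rightarrow> complex^'s) \<Rightarrow> bool" where
  "parallel_spinor M \<psi> \<longleftrightarrow> spinor_field M \<psi> \<and> nontrivial_spinor M \<psi> \<and>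
     (\<forall>i\<in>index M. \<forall>p\<in>chart_dom M i. \<forall>v. spin_deriv M \<psi> i p v = 0)"

section \<open>Riemannian products\<close>

definition kronecker :: "complex^'s::finite^'s \<Rightarrow> complex^'t::finite^'t \<Rightarrow> complex^('s \<times> 't)^('s \<times> 't)" where
  "kronecker A B = (\<chi> k l. A $ fst k $ fst l * B $ snd k $ snd l)"

text \<open>
  The complex volume element \<open>\<i>\<^sup>m e\<^sub>1 \<cdots> e\<^sub>n\<close> for \<open>n = 2 m\<close>. It squares to the identity and anticommutes with
  all vectors. The choice of the ordered orthonormal basis affects only its sign.
\<close>

definition volume_element :: "('a::euclidean_space \<Rightarrow> complex^'s::finite^'s) \<Rightarrow> complex^'s^'s" where
  "volume_element c = mat (\<i> ^ (DIM('a) div 2)) **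
     foldr (\<lambda>v A. c v ** A) (SOME bs. distinct bs \<and> set bs = Basis) (mat 1)"

text \<open>
  The Riemannian product with the product spin structure, for a first factor of even dimension.
  The Dirac spinors of the product are the tensor products of those of the factors, with
  \<open>(x, y) \<cdot> (\<phi> \<otimes> \<psi>) = (x \<cdot> \<phi>) \<otimes> \<psi> + (\<omega> \<cdot> \<phi>) \<otimes> (y \<cdot> \<psi>)\<close> where \<open>\<omega>\<close> is the complex volume element of the
  first factor. Under this identification a product of spin group elements \<open>g\<close> and \<open>h\<close> of the
  factors acts as \<open>g \<otimes> h\<close>, because \<open>h\<close> is a product of an even number of vectors.
\<close>

definition spin_product ::
    "('p, 'i, 'a::euclidean_space, 's::finite) spin \<Rightarrow> ('q, 'j, 'b::euclidean_space, 't::finite) spin \<Rightarrow>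
     ('p \<times> 'q, 'i \<times> 'j, 'a \<times> 'b, 's \<times> 't) spin" where
  "spin_product M N = \<lparr>
     mtop = prod_topology (mtop M) (mtop N),
     index = index M \<times> index N,
     chart_dom = (\<lambda>(i, j). chart_dom M i \<times> chart_dom N j),
     chart = (\<lambda>(i, j) (p, q). (chart M i p, chart N j q)),
     metric = (\<lambda>(i, j) (p, q) (v, w) (v', w'). metric M i p v v' + metric N j q w w'),
     frame = (\<lambda>(i, j) (p, q) (v, w). (frame M i p v, frame N j q w)),
     spin_trans = (\<lambda>(i, j) (i', j') (p, q). kronecker (spin_trans M i i' p) (spin_trans N j j' q)),
     cliff = (\<lambda>(x, y). kronecker (cliff M x) (mat 1) +
       kronecker (volume_element (cliff M)) (cliff N y)) \<rparr>"

text \<open>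
  The coordinate form of the product structure in a product chart: the identity on vectors tangent
  to the first factor, minus the identity on vectors tangent to the second factor.
\<close>

definition product_structure :: "'a \<times> 'b \<Rightarrow> 'a \<times> 'b::uminus" where
  "product_structure = (\<lambda>(v, w). (v, - w))"

section \<open>The circle\<close>

text \<open>
  The unit circle with the angle charts centred at \<open>cis t\<close>. The frame is the global unit tangent
  field, and the trivial cocycle is the spin structure admitting parallel spinors.
\<close>

definition spin_circle :: "(complex, real, real, 1) spin" where
  "spin_circle = \<lparr>
     mtop = top_of_set (sphere 0 1),
     index = UNIV,
     chart_dom = (\<lambda>t. sphere 0 1 - {- cis t}),
     chart = (\<lambda>t z. t + Arg (z * cis (- t))),
     metric = (\<lambda>t z v w. v * w),
     frame = (\<lambda>t z v. v),
     spin_trans = (\<lambda>s t z. mat 1),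
     cliff = (\<lambda>x. mat (\<i> * complex_of_real x)) \<rparr>"

end

theory Submission
  imports Defs
begin

text \<open>
  The solution is the tensor product \<open>\<psi>\<^sup>* = \<psi>\<^sub>1 \<otimes> \<psi>\<^sub>2\<close> of the Killing spinor with the parallel spinor, and both
  the eigenvalue and \<open>\<lambda>\<^sup>*\<close> are \<open>\<lambda>\<^sub>1\<close>. The spin derivative of a Riemannian product obeys a Leibniz rule
  (\<open>spin_deriv_tensor\<close>), so for a tangent vector \<open>X = (v, w)\<close>
  \<open>\<nabla>\<^sub>X \<psi>\<^sup>* = (\<nabla>\<^sub>v \<psi>\<^sub>1) \<otimes> \<psi>\<^sub>2 = - (\<lambda>\<^sub>1 / n\<^sub>1) (v \<cdot> \<psi>\<^sub>1) \<otimes> \<psi>\<^sub>2 = - (\<lambda>\<^sub>1 / n\<^sub>1) (v, 0) \<cdot> \<psi>\<^sup>*\<close>,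
  and \<open>2 (v, 0) = X + \<phi>(X)\<close> turns this into the asserted equation. In the Dirac operator of the product
  the directions tangent to the second factor contribute nothing, and those tangent to the first give
  \<open>(D\<^sub>1 \<psi>\<^sub>1) \<otimes> \<psi>\<^sub>2\<close>.

  Two points need an argument. The Leibniz rule rests on the fact that the Levi-Civita connection of a
  product splits. Christoffel symbols are characterised by a property that determines them uniquely,
  so it is enough that the pair of the two Christoffel symbols has this property; the existence of
  the symbols of the factors is the Koszul formula (\<open>metric_connection_exists\<close>). The connection terms of
  the second factor enter as \<open>\<omega>\<^sup>2 \<psi>\<^sub>1 \<otimes> (e\<^sub>a \<cdot> e\<^sub>b \<cdot> \<psi>\<^sub>2)\<close>, and \<open>\<omega>\<^sup>2 = 1\<close> for the complex volume element
  (\<open>volume_element_square\<close>).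
  Secondly, the Killing equation speaks of vector fields on the first factor. Fixing the point of
  the second factor turns a vector field on the product into one on the first factor
  (\<open>vector_field_slice\<close>), so no extension of tangent vectors to vector fields is needed.

  The circle is a flat spin manifold on which the constant spinor is parallel, so the case of
  \<open>S\<^sup>1\<close> is an instance of the general one.
\<close>

section \<open>Smooth maps\<close>

lemma C_on_cong:
  assumes "open S" "\<And>x. x \<in> S \<Longrightarrow> f x = g x" "C_on k f S"
  shows "C_on k g S"
  using assms(2,3)
proof (induction k arbitrary: f g)
  case 0
  then show ?case using continuous_on_cong[of S S f g] by simp
next
  case (Suc k)
  have der: "frechet_derivative f (at x) = frechet_derivative g (at x)" if "x \<in> S" for x
    by (rule frechet_derivative_transform_within_open[OF _ \<open>open S\<close> that])
      (use Suc.prems that in auto)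
  have "g differentiable (at x)" if "x \<in> S" for x
  proof -
    have "(f has_derivative frechet_derivative f (at x)) (at x)"
      using Suc.prems that by (simp flip: frechet_derivative_works)
    then have "(g has_derivative frechet_derivative f (at x)) (at x)"
      using has_derivative_transform_within_open[OF _ \<open>open S\<close> that] Suc.prems(1) by blast
    then show ?thesis by (rule differentiableI)
  qed
  moreover have "C_on k (\<lambda>x. frechet_derivative g (at x) v) S" for v
    using Suc.IH[of "\<lambda>x. frechet_derivative f (at x) v"] Suc.prems(2) der by simp
  ultimately show ?case by simp
qed

lemma smooth_on_cong:
  assumes "open S" "\<And>x. x \<in> S \<Longrightarrow> f x = g x" "smooth_on f S"
  shows "smooth_on g S"
  using assms C_on_cong unfolding smooth_on_def by blast

lemma C_on_imp_continuous_on: "C_on k f S \<Longrightarrow> continuous_on S f"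
proof (cases k)
  case (Suc n)
  assume "C_on k f S"
  with Suc have "f differentiable_on S"
    by (auto simp: differentiable_on_def intro: differentiable_at_withinI)
  then show ?thesis by (rule differentiable_imp_continuous_on)
qed simp

lemma C_on_Suc_imp: "C_on (Suc k) f S \<Longrightarrow> C_on k f S"
proof (induction k arbitrary: f)
  case 0
  then show ?case using C_on_imp_continuous_on[of "Suc 0" f S] by simp
next
  case (Suc k)
  then show ?case unfolding C_on.simps(2)[of "Suc k"] C_on.simps(2)[of k] by blast
qed

lemma smooth_on_imp_differentiable: "smooth_on f S \<Longrightarrow> x \<in> S \<Longrightarrow> f differentiable (at x)"
  unfolding smooth_on_def by (metis C_on.simps(2))

lemma C_on_add:
  assumes "open S" "C_on k f S" "C_on k g S"
  shows "C_on k (\<lambda>x. f x + g x) S"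
  using assms(2,3)
proof (induction k arbitrary: f g)
  case 0
  then show ?case by (simp add: continuous_on_add)
next
  case (Suc k)
  have der: "((\<lambda>x. f x + g x) has_derivative
      (\<lambda>v. frechet_derivative f (at x) v + frechet_derivative g (at x) v)) (at x)" if "x \<in> S" for x
    using Suc.prems that by (intro has_derivative_add) (auto simp: frechet_derivative_works)
  have "C_on k (\<lambda>x. frechet_derivative (\<lambda>x. f x + g x) (at x) v) S" for v
    by (rule C_on_cong[OF assms(1) _ Suc.IH[of "\<lambda>x. frechet_derivative f (at x) v"
            "\<lambda>x. frechet_derivative g (at x) v"]])
      (use Suc.prems in \<open>auto simp: frechet_derivative_at[OF der, symmetric]\<close>)
  then show ?case using der by (auto simp: differentiable_def)
qed

text \<open>
  The derivative along \<open>(v, w)\<close> is \<open>B (f' v) g + B f (g' w)\<close>, a sum of two terms of the same shape, so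
  the induction on the order closes.
\<close>

lemma C_on_bilinear_separate:
  assumes B: "bounded_bilinear B" and "open S" "open T" "C_on k f S" "C_on k g T"
  shows "C_on k (\<lambda>(x, y). B (f x) (g y)) (S \<times> T)"
  using assms(4,5)
proof (induction k arbitrary: f g)
  case 0
  interpret bounded_bilinear B by fact
  have "continuous_on (S \<times> T) (\<lambda>z. f (fst z))" "continuous_on (S \<times> T) (\<lambda>z. g (snd z))"
    using 0 by (auto intro!: continuous_on_compose2[of S f] continuous_on_compose2[of T g]
        continuous_on_fst continuous_on_snd)
  then show ?case by (simp add: case_prod_unfold continuous_on)
next
  case (Suc k)
  interpret bounded_bilinear B by fact
  let ?h = "\<lambda>(x, y). B (f x) (g y)"
  have der: "(?h has_derivative (\<lambda>v. B (f (fst z)) (frechet_derivative g (at (snd z)) (snd v))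
      + B (frechet_derivative f (at (fst z)) (fst v)) (g (snd z)))) (at z)" if "z \<in> S \<times> T" for z
  proof -
    have "((\<lambda>z. f (fst z)) has_derivative (\<lambda>v. frechet_derivative f (at (fst z)) (fst v))) (at z)"
      using Suc.prems that
      by (intro has_derivative_compose[OF has_derivative_fst[OF has_derivative_ident]])
        (auto simp: frechet_derivative_works)
    moreover
    have "((\<lambda>z. g (snd z)) has_derivative (\<lambda>v. frechet_derivative g (at (snd z)) (snd v))) (at z)"
      using Suc.prems that
      by (intro has_derivative_compose[OF has_derivative_snd[OF has_derivative_ident]])
        (auto simp: frechet_derivative_works)
    ultimately show ?thesis using FDERIV by (simp add: case_prod_unfold)
  qed
  have "C_on k (\<lambda>z. frechet_derivative ?h (at z) v) (S \<times> T)" for v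
  proof (rule C_on_cong)
    show "open (S \<times> T)" using assms by (simp add: open_Times)
    show "C_on k (\<lambda>z. (\<lambda>(x, y). B (f x) (frechet_derivative g (at y) (snd v))) z
        + (\<lambda>(x, y). B (frechet_derivative f (at x) (fst v)) (g y)) z) (S \<times> T)"
      by (rule C_on_add[OF \<open>open (S \<times> T)\<close> Suc.IH Suc.IH])
        (use Suc.prems C_on_Suc_imp in \<open>auto\<close>)
  qed (auto simp: frechet_derivative_at[OF der, symmetric])
  moreover have "?h differentiable (at z)" if "z \<in> S \<times> T" for z
    using der[OF that] by (auto simp: differentiable_def)
  ultimately show ?case by auto
qed

text \<open>
  Used with \<open>L = fst\<close> to restrict the first component of a vector field on a product to a slice. Having
  \<open>L\<close> outside lets one induction cover restriction and projection.
\<close>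

lemma C_on_slice:
  assumes "bounded_linear L" "open S" "y \<in> T" "C_on k f (S \<times> T)"
  shows "C_on k (\<lambda>x. L (f (x, y))) S"
  using assms(4)
proof (induction k arbitrary: f)
  case 0
  have "continuous_on S (\<lambda>x. f (x, y))"
    using 0 assms(3) by (auto intro!: continuous_on_compose2[of "S \<times> T" f] continuous_intros)
  then show ?case using bounded_linear.continuous_on[OF assms(1)] by simp
next
  case (Suc k)
  have der: "((\<lambda>x. L (f (x, y))) has_derivative
      (\<lambda>v. L (frechet_derivative f (at (x, y)) (v, 0)))) (at x)" if "x \<in> S" for x
  proof -
    have "((\<lambda>x. (x, y)) has_derivative (\<lambda>v. (v, 0))) (at x)"
      by (intro has_derivative_Pair has_derivative_ident has_derivative_const)
    then have "((\<lambda>x. f (x, y)) has_derivative (\<lambda>v. frechet_derivative f (at (x, y)) (v, 0))) (at x)"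
      by (rule has_derivative_compose[OF _ frechet_derivative_works[THEN iffD1]])
        (use Suc.prems that assms(3) in auto)
    then show ?thesis by (rule bounded_linear.has_derivative[OF assms(1)])
  qed
  have "C_on k (\<lambda>x. frechet_derivative (\<lambda>x. L (f (x, y))) (at x) v) S" for v
    by (rule C_on_cong[OF assms(2) _ Suc.IH[of "\<lambda>z. frechet_derivative f (at z) (v, 0)"]])
      (use Suc.prems in \<open>auto simp: frechet_derivative_at[OF der, symmetric]\<close>)
  then show ?case using der by (auto simp: differentiable_def)
qed

text \<open>
  Covers the only two kinds of functions that occur on the circle: constants, and transition maps,
  which are locally translations.
\<close>

lemma smooth_on_constant_derivative:
  assumes "open S" "\<And>x. x \<in> S \<Longrightarrow> (f has_derivative L) (at x)"
  shows "smooth_on f S"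
proof -
  have "C_on k f S" for k
    using assms(2)
  proof (induction k arbitrary: f L)
    case 0
    then show ?case
      by (auto intro!: continuous_at_imp_continuous_on has_derivative_continuous)
  next
    case (Suc k)
    have "((\<lambda>x. frechet_derivative f (at x) v) has_derivative (\<lambda>_. 0)) (at x)" if "x \<in> S" for x v
      by (rule has_derivative_transform_within_open[OF has_derivative_const[of "L v"] assms(1) that])
        (metis Suc.prems frechet_derivative_at)
    then have "C_on k (\<lambda>x. frechet_derivative f (at x) v) S" for v
      by (rule Suc.IH)
    moreover have "f differentiable (at x)" if "x \<in> S" for x
      using Suc.prems[OF that] by (rule differentiableI)
    ultimately show ?case by simp
  qed
  then show ?thesis by (simp add: smooth_on_def)
qed

section \<open>Tensor products of spinors and the volume element\<close>

definition tensor :: "complex^'s \<Rightarrow> complex^'t \<Rightarrow> complex^('s::finite \<times> 't::finite)" where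
  "tensor a b = (\<chi> k. a $ fst k * b $ snd k)"

lemma bounded_bilinear_tensor: "bounded_bilinear tensor"
proof -
  have "bilinear (tensor :: complex^'s \<Rightarrow> complex^'t \<Rightarrow> _)"
    unfolding bilinear_def
    by (auto intro!: linearI simp: tensor_def vec_eq_iff algebra_simps)
  then show ?thesis by (rule bilinear_conv_bounded_bilinear[THEN iffD1])
qed

lemma bounded_bilinear_matrix_vector_mult:
  "bounded_bilinear ((*v) :: complex^'t::finite^'s::finite \<Rightarrow> complex^'t \<Rightarrow> complex^'s)"
proof -
  have "bilinear ((*v) :: complex^'t^'s \<Rightarrow> complex^'t \<Rightarrow> complex^'s)"
    unfolding bilinear_def
    by (auto intro!: linearI simp: matrix_vector_mult_def vec_eq_iff algebra_simps sum.distrib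
        scaleR_sum_right)
  then show ?thesis by (rule bilinear_conv_bounded_bilinear[THEN iffD1])
qed

lemma tensor_nonzero: "a \<noteq> 0 \<Longrightarrow> b \<noteq> 0 \<Longrightarrow> tensor a b \<noteq> 0"
  by (auto simp: tensor_def vec_eq_iff)

lemma kronecker_tensor: "kronecker A B *v tensor a b = tensor (A *v a) (B *v b)"
proof -
  have "(\<Sum>k\<in>UNIV. f k) = (\<Sum>i\<in>UNIV. \<Sum>j\<in>UNIV. f (i, j))" for f :: "'a \<times> 'b \<Rightarrow> complex"
    by (simp add: sum.cartesian_product)
  then show ?thesis
    by (simp add: kronecker_def tensor_def matrix_vector_mult_def vec_eq_iff sum_product mult_ac)
qed

lemma matrix_mult_minus:
  fixes A B :: "complex^'s::finite^'s"
  shows "A ** (- B) = - (A ** B)" "(- A) ** B = - (A ** B)"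
  by (simp_all add: vec_eq_iff matrix_matrix_mult_def sum_negf)

lemma clifford_anticommute:
  fixes c :: "'a::euclidean_space \<Rightarrow> complex^'s::finite^'s"
  assumes "spinor_module c" "v \<bullet> w = 0"
  shows "c v ** c w = - (c w ** c v)"
proof -
  have "c v ** c w + c w ** c v = mat (complex_of_real (- 2 * (v \<bullet> w)))"
    using assms(1) by (simp add: spinor_module_def)
  also have "\<dots> = 0"
    using assms(2) by (simp add: mat_def vec_eq_iff)
  finally show ?thesis by (simp add: eq_neg_iff_add_eq_0)
qed

lemma clifford_square:
  fixes c :: "'a::euclidean_space \<Rightarrow> complex^'s::finite^'s"
  assumes "spinor_module c" "norm v = 1"
  shows "c v ** c v = - mat 1"
proof -
  have "c v ** c v + c v ** c v = mat (complex_of_real (- 2 * (v \<bullet> v)))"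
    using assms(1) by (simp add: spinor_module_def)
  also have "v \<bullet> v = 1" using assms(2) by (simp add: dot_square_norm)
  finally have "(2::complex) * ((c v ** c v) $ i $ j) = - 2 * mat 1 $ i $ j" for i j
    by (simp add: vec_eq_iff mat_def)
  then show ?thesis by (simp add: vec_eq_iff)
qed

text \<open>
  Moving the first letter through the remaining ones to meet its other copy costs one sign for each
  of them, and its square costs one more. A word of length \<open>n\<close> thus collects
  \<open>1 + 2 + \<dots> + n\<close> signs.
\<close>

lemma clifford_word_square:
  fixes c :: "'a::euclidean_space \<Rightarrow> complex^'s::finite^'s"
  assumes "spinor_module c" "distinct bs" "set bs \<subseteq> Basis"
  defines "P \<equiv> foldr (\<lambda>v A. c v ** A)"
  shows "P bs (mat 1) ** P bs (mat 1) = (-1) ^ (length bs * (length bs + 1) div 2) *\<^sub>R mat 1"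
  using assms(2,3)
proof (induction bs)
  case Nil
  then show ?case by (simp add: P_def)
next
  case (Cons b bs)
  let ?Q = "P bs (mat 1)"
  have comm: "P xs (mat 1) ** c b = (-1) ^ length xs *\<^sub>R (c b ** P xs (mat 1))"
    if "set xs \<subseteq> Basis - {b}" for xs
    using that
  proof (induction xs)
    case Nil
    then show ?case by (simp add: P_def)
  next
    case (Cons x xs)
    have "P (x # xs) (mat 1) ** c b = c x ** (P xs (mat 1) ** c b)"
      by (simp add: P_def matrix_mul_assoc)
    also have "\<dots> = (-1) ^ length xs *\<^sub>R ((c x ** c b) ** P xs (mat 1))"
      using Cons by (simp add: matrix_scalar_ac scalar_matrix_assoc[symmetric] matrix_mul_assoc)
    also have "c x ** c b = - (c b ** c x)"
      using Cons.prems \<open>set (b # bs) \<subseteq> Basis\<close>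
      by (intro clifford_anticommute assms(1)) (auto intro: inner_not_same_Basis)
    finally show ?case by (simp add: P_def matrix_mul_assoc matrix_mult_minus scalar_matrix_assoc[symmetric])
  qed
  have "P (b # bs) (mat 1) ** P (b # bs) (mat 1) = c b ** (?Q ** c b) ** ?Q"
    by (simp add: P_def matrix_mul_assoc)
  also have "\<dots> = (-1) ^ length bs *\<^sub>R ((c b ** c b) ** (?Q ** ?Q))"
  proof -
    have "?Q ** c b = (-1) ^ length bs *\<^sub>R (c b ** ?Q)"
      using comm[of bs] Cons.prems by auto
    then show ?thesis
      by (simp add: matrix_scalar_ac scalar_matrix_assoc[symmetric] matrix_mul_assoc)
  qed
  also have "\<dots> = (-1) ^ Suc (length bs) *\<^sub>R (?Q ** ?Q)"
    using clifford_square[OF assms(1), of b] Cons.prems by (simp add: matrix_mult_minus)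
  also have "\<dots> = (-1) ^ (Suc (length bs) + length bs * (length bs + 1) div 2) *\<^sub>R mat 1"
    using Cons by (simp add: power_add)
  also have "Suc (length bs) + length bs * (length bs + 1) div 2 =
      length (b # bs) * (length (b # bs) + 1) div 2"
    by simp
  finally show ?case .
qed

text \<open>
  For \<open>n = 2 m\<close> the square of \<open>e\<^sub>1 \<cdots> e\<^sub>n\<close> is \<open>(-1) ^ (m * (2 * m + 1)) = (-1) ^ m\<close>, which is cancelled by
  the square of the factor \<open>\<i> ^ m\<close>.
\<close>

lemma volume_element_square:
  fixes c :: "'a::euclidean_space \<Rightarrow> complex^'s::finite^'s"
  assumes "spinor_module c" "even (DIM('a))"
  shows "volume_element c ** volume_element c = mat 1"
proof -
  obtain m where m: "DIM('a) = 2 * m" using assms(2) by (rule evenE)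
  define bs where "bs = (SOME bs. distinct bs \<and> set bs = (Basis :: 'a set))"
  define P where "P = foldr (\<lambda>v A. c v ** A) bs (mat 1)"
  have bs: "distinct bs \<and> set bs = (Basis :: 'a set)"
    unfolding bs_def by (rule someI_ex) (use finite_distinct_list[OF finite_Basis] in blast)
  then have len: "length bs = 2 * m"
    using m by (metis distinct_card)
  have sq: "P ** P = (-1) ^ (m * (2 * m + 1)) *\<^sub>R mat 1"
    using clifford_word_square[OF assms(1), of bs] bs len
    unfolding P_def by (simp add: mult.assoc algebra_simps)
  have comm: "A ** mat z = mat z ** A" for A :: "complex^'s^'s" and z
    by (simp add: vec_eq_iff matrix_matrix_mult_def mat_def if_distrib[of "\<lambda>x. x * _"]
        if_distrib[of "\<lambda>x. _ * x"] mult.commute cong: if_cong)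
  have z: "mat z ** mat w = (mat (z * w) :: complex^'s^'s)" for z w
    by (simp add: vec_eq_iff matrix_matrix_mult_def mat_def if_distrib[of "\<lambda>x. x * _"]
        if_distrib[of "\<lambda>x. _ * x"] cong: if_cong)
  have scale: "mat w ** (k *\<^sub>R mat 1) = (mat (w * of_real k) :: complex^'s^'s)" for w k
    by (simp add: matrix_scalar_ac) (simp add: vec_eq_iff mat_def scaleR_conv_of_real[where 'a = complex])
  have "volume_element c ** volume_element c = mat (\<i> ^ m) ** (P ** mat (\<i> ^ m)) ** P"
    by (simp add: volume_element_def m P_def bs_def matrix_mul_assoc)
  also have "\<dots> = (mat (\<i> ^ m) ** mat (\<i> ^ m)) ** (P ** P)"
    by (simp only: comm[of P] matrix_mul_assoc)
  also have "\<dots> = mat (\<i> ^ m * \<i> ^ m * (-1) ^ (m * (2 * m + 1)))"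
    using scale[of _ "(-1) ^ (m * (2 * m + 1))"] by (simp only: sq z) simp
  also have "\<i> ^ m * \<i> ^ m * (-1) ^ (m * (2 * m + 1)) = ((-1) ^ m * (-1) ^ m * ((-1) ^ (2 * m)) ^ m :: complex)"
    by (simp add: power_mult_distrib[symmetric] power_mult[symmetric] power_add[symmetric] algebra_simps)
  also have "\<dots> = 1" by (simp add: power_mult_distrib[symmetric])
  finally show ?thesis .
qed

section \<open>Charts\<close>

text \<open>
  Enough for derivatives in a single chart, and evidently inherited by product charts.
\<close>

definition coordinate_chart :: "('p, 'i, 'a::euclidean_space, 'z) atlas_scheme \<Rightarrow> 'i \<Rightarrow> bool" where
  "coordinate_chart M i \<longleftrightarrow>
     inj_on (chart M i) (chart_dom M i) \<and> open (chart M i ` chart_dom M i)"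

lemma smooth_manifold_coordinate_chart:
  assumes "smooth_manifold M" "i \<in> index M"
  shows "coordinate_chart M i"
proof -
  have dom: "openin (mtop M) (chart_dom M i)" and img: "open (chart M i ` chart_dom M i)"
    and hom: "homeomorphic_map (subtopology (mtop M) (chart_dom M i))
          (top_of_set (chart M i ` chart_dom M i)) (chart M i)"
    using assms by (auto simp: smooth_manifold_def)
  have "topspace (subtopology (mtop M) (chart_dom M i)) = chart_dom M i"
    using openin_subset[OF dom] by auto
  then show ?thesis
    using homeomorphic_imp_injective_map[OF hom] img by (simp add: coordinate_chart_def)
qed

lemma in_chart_chart:
  "coordinate_chart M i \<Longrightarrow> p \<in> chart_dom M i \<Longrightarrow> in_chart M i f (chart M i p) = f p"
  by (simp add: coordinate_chart_def in_chart_def)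

lemma smooth_in_chart_iff:
  assumes "coordinate_chart M i" "\<And>p. p \<in> chart_dom M i \<Longrightarrow> f p = F (chart M i p)"
  shows "smooth_in_chart M i (chart_dom M i) f \<longleftrightarrow> smooth_on F (chart M i ` chart_dom M i)"
proof -
  have o: "open (chart M i ` chart_dom M i)"
    using assms(1) by (simp add: coordinate_chart_def)
  have "in_chart M i f x = F x" if "x \<in> chart M i ` chart_dom M i" for x
    using that assms(2) by (auto simp: in_chart_chart[OF assms(1)])
  then show ?thesis
    unfolding smooth_in_chart_def
    using smooth_on_cong[OF o, of "in_chart M i f" F] smooth_on_cong[OF o, of F "in_chart M i f"]
    by auto
qed

lemma chart_deriv_has_derivative:
  assumes "smooth_in_chart M i S f" "p \<in> S"
  shows "(in_chart M i f has_derivative chart_deriv M i f p) (at (chart M i p))"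
  unfolding chart_deriv_def
  using assms smooth_on_imp_differentiable[of "in_chart M i f" "chart M i ` S"]
  by (auto simp: smooth_in_chart_def frechet_derivative_works[symmetric])

text \<open>
  Chart images are open, so the derivative in a chart may be computed from any coordinate expression
  valid on the chart domain, without reference to the inverse of the chart.
\<close>

lemma chart_deriv_eqI:
  assumes "coordinate_chart M i" "p \<in> chart_dom M i"
    and F: "(F has_derivative F') (at (chart M i p))"
    and eq: "\<And>q. q \<in> chart_dom M i \<Longrightarrow> f q = F (chart M i q)"
  shows "chart_deriv M i f p = F'"
proof -
  have "(in_chart M i f has_derivative F') (at (chart M i p))"
    by (rule has_derivative_transform_within_open[OF F, of "chart M i ` chart_dom M i"])
      (use assms in \<open>auto simp: in_chart_chart[OF assms(1)] coordinate_chart_def\<close>)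
  then show ?thesis
    unfolding chart_deriv_def using frechet_derivative_at by blast
qed

lemma chart_deriv_linear_combination:
  assumes ch: "coordinate_chart M i" "p \<in> chart_dom M i"
    and f: "smooth_in_chart M i (chart_dom M i) f" and g: "smooth_in_chart M i (chart_dom M i) g"
    and h: "\<And>q. q \<in> chart_dom M i \<Longrightarrow> h q = a *\<^sub>R f q + b *\<^sub>R g q"
  shows "chart_deriv M i h p u = a *\<^sub>R chart_deriv M i f p u + b *\<^sub>R chart_deriv M i g p u"
proof -
  have "chart_deriv M i h p = (\<lambda>u. a *\<^sub>R chart_deriv M i f p u + b *\<^sub>R chart_deriv M i g p u)"
    by (rule chart_deriv_eqI[OF ch, where F = "\<lambda>x. a *\<^sub>R in_chart M i f x + b *\<^sub>R in_chart M i g x"])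
      (auto intro!: has_derivative_add has_derivative_scaleR_right chart_deriv_has_derivative f g ch
        simp: h in_chart_chart[OF ch(1)])
  then show ?thesis by simp
qed

section \<open>Christoffel symbols\<close>

definition inner_product_form :: "('a::euclidean_space \<Rightarrow> 'a \<Rightarrow> real) \<Rightarrow> bool" where
  "inner_product_form g \<longleftrightarrow>
     bilinear g \<and> (\<forall>v w. g v w = g w v) \<and> (\<forall>v. v \<noteq> 0 \<longrightarrow> g v v > 0)"

lemma inner_product_form_nondegenerate:
  assumes "inner_product_form g" "\<And>w. g x w = g y w"
  shows "x = y"
proof -
  have "g (x - y) (x - y) = 0"
    using bilinear_lsub[of g x y "x - y"] assms(1) assms(2)[of "x - y"]
    unfolding inner_product_form_def by linarith
  then show ?thesis
    using assms(1) unfolding inner_product_form_def by (metis less_irrefl right_minus_eq)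
qed

text \<open>
  A linear functional is determined by its values on the standard basis, and \<open>x \<mapsto> (g x b)\<^sub>b\<close> is an
  injective, hence surjective, endomorphism.
\<close>

lemma inner_product_form_represents:
  assumes g: "inner_product_form g" and K: "linear K"
  shows "\<exists>x. \<forall>w. g x w = K w"
proof -
  have bil: "bilinear g" using g by (simp add: inner_product_form_def)
  define T where "T x = (\<Sum>b\<in>Basis. g x b *\<^sub>R b)" for x
  have lin: "linear T"
    by (rule linearI) (simp_all add: T_def bilinear_ladd[OF bil] bilinear_lmul[OF bil]
        scaleR_add_left sum.distrib scaleR_sum_right)
  have T: "T x \<bullet> b = g x b" if "b \<in> Basis" for x b
    using that by (simp add: T_def)
  have extend: "g x w = L w" if "linear L" "\<And>b. b \<in> Basis \<Longrightarrow> g x b = L b" for x w L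
    using linear_eq_stdbasis[of "g x" L] bil that by (auto simp: bilinear_def)
  have "inj T"
  proof (rule injI)
    fix x y assume "T x = T y"
    then have "g x b = g y b" if "b \<in> Basis" for b using T that by metis
    then have "g x w = g y w" for w
      using extend[of "g y" x w] bil by (simp add: bilinear_def)
    then show "x = y" by (rule inner_product_form_nondegenerate[OF g])
  qed
  then obtain x where "T x = (\<Sum>b\<in>Basis. K b *\<^sub>R b)"
    using linear_injective_imp_surjective[OF lin] by (metis surjD)
  then have "g x b = K b" if "b \<in> Basis" for b
    using T[OF that, of x] that by simp
  then show ?thesis using extend[OF K] by blast
qed

text \<open>
  Christoffel symbols at one point as a notion of linear algebra: \<open>D u v w\<close> stands for the derivative
  along \<open>u\<close> of \<open>g v w\<close>. Symmetry of \<open>\<Gamma>\<close> is the absence of torsion, the last condition is compatibility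
  with the metric.
\<close>

definition metric_connection ::
    "('a::euclidean_space \<Rightarrow> 'a \<Rightarrow> 'a \<Rightarrow> real) \<Rightarrow> ('a \<Rightarrow> 'a \<Rightarrow> real) \<Rightarrow> ('a \<Rightarrow> 'a \<Rightarrow> 'a) \<Rightarrow> bool" where
  "metric_connection D g \<Gamma> \<longleftrightarrow> bilinear \<Gamma> \<and> (\<forall>u v. \<Gamma> u v = \<Gamma> v u) \<and>
     (\<forall>u v w. D u v w = g (\<Gamma> u v) w + g v (\<Gamma> u w))"

text \<open>
  The Koszul formula expresses \<open>g (\<Gamma> u v) w\<close> through \<open>D\<close> alone.
\<close>

lemma metric_connection_unique:
  assumes g: "inner_product_form g" and "metric_connection D g \<Gamma>" "metric_connection D g \<Gamma>'"
  shows "\<Gamma> = \<Gamma>'"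
proof -
  have koszul: "2 * g (\<Delta> u v) w = D u v w + D v u w - D w u v"
    if "metric_connection D g \<Delta>" for \<Delta> u v w
  proof -
    have s: "g x y = g y x" for x y using g by (simp add: inner_product_form_def)
    have t: "\<Delta> x y = \<Delta> y x" and d: "D x y z = g (\<Delta> x y) z + g y (\<Delta> x z)" for x y z
      using that by (auto simp: metric_connection_def)
    show ?thesis
      unfolding d using s[of v "\<Delta> u w"] s[of u "\<Delta> v w"] s[of u "\<Delta> w v"] t[of v u] t[of u w] t[of v w]
      by simp
  qed
  have "g (\<Gamma> u v) w = g (\<Gamma>' u v) w" for u v w
    using koszul[OF assms(2), of u v w] koszul[OF assms(3), of u v w] by linarith
  then have "\<Gamma> u v = \<Gamma>' u v" for u v
    by (rule inner_product_form_nondegenerate[OF g])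
  then show ?thesis by blast
qed

text \<open>
  Here the Koszul formula is the definition: its right-hand side is linear in \<open>w\<close>, so it is
  represented by a vector \<open>\<Gamma> u v\<close>.
\<close>

lemma metric_connection_exists:
  assumes g: "inner_product_form g"
    and lin: "\<And>v w. linear (\<lambda>u. D u v w)" and bil: "\<And>u. bilinear (D u)"
    and sym: "\<And>u v w. D u v w = D u w v"
  shows "\<exists>\<Gamma>. metric_connection D g \<Gamma>"
proof -
  have D: "D (x + y) v w = D x v w + D y v w" "D (r *\<^sub>R x) v w = r * D x v w"
    "D u (x + y) w = D u x w + D u y w" "D u (r *\<^sub>R x) w = r * D u x w"
    "D u v (x + y) = D u v x + D u v y" "D u v (r *\<^sub>R x) = r * D u v x" for r x y u v w
    using lin[of v w] by (auto simp: linear_iff bilinear_ladd[OF bil] bilinear_lmul[OF bil]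
        bilinear_radd[OF bil] bilinear_rmul[OF bil])
  have G: "g (x + y) z = g x z + g y z" "g (r *\<^sub>R x) z = r * g x z" "g x y = g y x" for r x y z
    using bilinear_ladd[of g x y z] bilinear_lmul[of g r x z] g
    unfolding inner_product_form_def by simp_all
  have "\<exists>x. \<forall>w. g x w = (D u v w + D v u w - D w u v) / 2" for u v
    by (rule inner_product_form_represents[OF g])
      (auto intro!: linearI simp: D algebra_simps diff_divide_distrib add_divide_distrib)
  then obtain \<Gamma> where \<Gamma>: "g (\<Gamma> u v) w = (D u v w + D v u w - D w u v) / 2" for u v w
    by metis
  note nd = inner_product_form_nondegenerate[OF g]
  have "\<Gamma> u v = \<Gamma> v u" for u v
    by (rule nd) (simp add: \<Gamma> sym[of _ u v])
  moreover have "bilinear \<Gamma>"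
    unfolding bilinear_def
    by (auto intro!: linearI nd simp: \<Gamma> D G(1,2) algebra_simps diff_divide_distrib add_divide_distrib)
  moreover have "D u v w = g (\<Gamma> u v) w + g v (\<Gamma> u w)" for u v w
    using G(3)[of v "\<Gamma> u w"] sym[of u v w] sym[of v u w] sym[of w u v] by (simp add: \<Gamma> field_simps)
  ultimately show ?thesis by (auto simp: metric_connection_def)
qed

lemma christoffel_eqI:
  assumes "inner_product_form (metric M i p)"
    "metric_connection (\<lambda>u v w. chart_deriv M i (\<lambda>q. metric M i q v w) p u) (metric M i p) \<Gamma>"
  shows "christoffel M i p = \<Gamma>"
proof -
  have "christoffel M i p = (THE \<Gamma>. metric_connection
      (\<lambda>u v w. chart_deriv M i (\<lambda>q. metric M i q v w) p u) (metric M i p) \<Gamma>)"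
    by (simp add: christoffel_def metric_connection_def)
  also have "\<dots> = \<Gamma>"
    using assms metric_connection_unique by (blast intro: the_equality)
  finally show ?thesis .
qed

lemma riemannian_inner_product_form:
  "riemannian_manifold M \<Longrightarrow> i \<in> index M \<Longrightarrow> p \<in> chart_dom M i \<Longrightarrow>
     inner_product_form (metric M i p)"
  by (simp add: riemannian_manifold_def inner_product_form_def)

lemma christoffel_metric_connection:
  assumes "riemannian_manifold M" "i \<in> index M" "p \<in> chart_dom M i"
  shows "metric_connection (\<lambda>u v w. chart_deriv M i (\<lambda>q. metric M i q v w) p u) (metric M i p)
    (christoffel M i p)"
proof -
  let ?D = "\<lambda>u v w. chart_deriv M i (\<lambda>q. metric M i q v w) p u"
  have ch: "coordinate_chart M i"
    using assms by (auto simp: riemannian_manifold_def intro: smooth_manifold_coordinate_chart)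
  have sm: "smooth_in_chart M i (chart_dom M i) (\<lambda>p. metric M i p v w)" for v w
    using assms by (simp add: riemannian_manifold_def)
  have form: "inner_product_form (metric M i q)" if "q \<in> chart_dom M i" for q
    by (rule riemannian_inner_product_form[OF assms(1,2) that])
  then have bil: "bilinear (metric M i q)" if "q \<in> chart_dom M i" for q
    using that by (simp add: inner_product_form_def)
  note comb = chart_deriv_linear_combination[OF ch assms(3) sm sm]
  have "linear (\<lambda>u. ?D u v w)" for v w
    using has_derivative_linear[OF chart_deriv_has_derivative[OF sm assms(3)]] .
  moreover have "?D u v w = ?D u w v" for u v w
    by (rule comb[of "\<lambda>q. metric M i q v w" 1 w v 0 w v u, simplified])
      (use form in \<open>unfold inner_product_form_def, blast\<close>)
  moreover have "bilinear (?D u)" for u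
    unfolding bilinear_def
  proof (intro conjI allI linearI)
    fix v w x r
    show "?D u v (w + x) = ?D u v w + ?D u v x"
      using comb[of "\<lambda>q. metric M i q v (w + x)" 1 v w 1 v x u] by (simp add: bilinear_radd[OF bil])
    show "?D u (w + x) v = ?D u w v + ?D u x v"
      using comb[of "\<lambda>q. metric M i q (w + x) v" 1 w v 1 x v u] by (simp add: bilinear_ladd[OF bil])
    show "?D u v (r *\<^sub>R w) = r *\<^sub>R ?D u v w"
      using comb[of "\<lambda>q. metric M i q v (r *\<^sub>R w)" r v w 0 v w u] by (simp add: bilinear_rmul[OF bil])
    show "?D u (r *\<^sub>R w) v = r *\<^sub>R ?D u w v"
      using comb[of "\<lambda>q. metric M i q (r *\<^sub>R w) v" r w v 0 w v u] by (simp add: bilinear_lmul[OF bil])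
  qed
  ultimately obtain \<Gamma> where "metric_connection ?D (metric M i p) \<Gamma>"
    using metric_connection_exists[OF form[OF assms(3)], of ?D] by blast
  then show ?thesis using christoffel_eqI[OF form[OF assms(3)]] by metis
qed

section \<open>The spin connection of a product\<close>

lemma sum_Basis_prod:
  fixes f :: "'a::euclidean_space \<times> 'b::euclidean_space \<Rightarrow> 'c::comm_monoid_add"
  shows "sum f Basis = (\<Sum>a\<in>Basis. f (a, 0)) + (\<Sum>b\<in>Basis. f (0, b))"
proof -
  have "inj_on (\<lambda>u. (u::'a, 0::'b)) Basis" "inj_on (\<lambda>u. (0::'a, u::'b)) Basis"
    by (auto intro!: inj_onI)
  then show ?thesis
    unfolding Basis_prod_def
    by (subst sum.union_disjoint) (auto simp: sum.reindex)
qed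

lemma spin_product_simps [simp]:
  "mtop (spin_product M N) = prod_topology (mtop M) (mtop N)"
  "index (spin_product M N) = index M \<times> index N"
  "chart_dom (spin_product M N) (i, j) = chart_dom M i \<times> chart_dom N j"
  "chart (spin_product M N) (i, j) (p, q) = (chart M i p, chart N j q)"
  "metric (spin_product M N) (i, j) (p, q) (v, w) (v', w') = metric M i p v v' + metric N j q w w'"
  "frame (spin_product M N) (i, j) (p, q) (v, w) = (frame M i p v, frame N j q w)"
  "spin_trans (spin_product M N) (i, j) (i', j') (p, q) =
     kronecker (spin_trans M i i' p) (spin_trans N j j' q)"
  "cliff (spin_product M N) (x, y) = kronecker (cliff M x) (mat 1) +
     kronecker (volume_element (cliff M)) (cliff N y)"
  by (simp_all add: spin_product_def)

lemma spin_product_chart_image: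
  "chart (spin_product M N) (i, j) ` (S \<times> T) = (chart M i ` S) \<times> (chart N j ` T)"
  by force

lemma coordinate_chart_spin_product:
  assumes "coordinate_chart M i" "coordinate_chart N j"
  shows "coordinate_chart (spin_product M N) (i, j)"
  using assms by (auto simp: coordinate_chart_def inj_on_def spin_product_chart_image open_Times)

text \<open>
  One chain rule for all fields on the product that are built from fields on the factors. The outer
  map \<open>H\<close> is addition for the metric, the identity for frames and transition maps, and the tensor
  product for spinors.
\<close>

lemma chart_deriv_spin_product:
  assumes M: "coordinate_chart M i" "p \<in> chart_dom M i" and N: "coordinate_chart N j" "q \<in> chart_dom N j"
    and f: "(in_chart M i f has_derivative f') (at (chart M i p))"
    and g: "(in_chart N j g has_derivative g') (at (chart N j q))"
    and H: "(H has_derivative H') (at (f p, g q))"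
    and F: "\<And>x y. x \<in> chart_dom M i \<Longrightarrow> y \<in> chart_dom N j \<Longrightarrow> F (x, y) = H (f x, g y)"
  shows "chart_deriv (spin_product M N) (i, j) F (p, q) = (\<lambda>(v, w). H' (f' v, g' w))"
proof (rule chart_deriv_eqI)
  show "coordinate_chart (spin_product M N) (i, j)"
    using M N by (simp add: coordinate_chart_spin_product)
  show "(p, q) \<in> chart_dom (spin_product M N) (i, j)" using M N by simp
  let ?z = "(chart M i p, chart N j q)"
  have "((\<lambda>z. in_chart M i f (fst z)) has_derivative (\<lambda>z. f' (fst z))) (at ?z)"
    by (rule has_derivative_compose[OF has_derivative_fst[OF has_derivative_ident]]) (simp add: f)
  moreover have "((\<lambda>z. in_chart N j g (snd z)) has_derivative (\<lambda>z. g' (snd z))) (at ?z)"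
    by (rule has_derivative_compose[OF has_derivative_snd[OF has_derivative_ident]]) (simp add: g)
  ultimately have "((\<lambda>z. (in_chart M i f (fst z), in_chart N j g (snd z))) has_derivative
      (\<lambda>z. (f' (fst z), g' (snd z)))) (at ?z)"
    by (rule has_derivative_Pair)
  from has_derivative_compose[OF this, of H H'] H
  show "((\<lambda>z. H (in_chart M i f (fst z), in_chart N j g (snd z))) has_derivative
      (\<lambda>(v, w). H' (f' v, g' w))) (at (chart (spin_product M N) (i, j) (p, q)))"
    using M N by (simp add: in_chart_chart case_prod_unfold)
  show "F x = H (in_chart M i f (fst (chart (spin_product M N) (i, j) x)),
      in_chart N j g (snd (chart (spin_product M N) (i, j) x)))"
    if "x \<in> chart_dom (spin_product M N) (i, j)" for x
    using that M N F by (auto simp: in_chart_chart)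
qed

lemma inner_product_form_spin_product:
  assumes "inner_product_form (metric M i p)" "inner_product_form (metric N j q)"
  shows "inner_product_form (metric (spin_product M N) (i, j) (p, q))"
proof -
  have b: "bilinear (metric M i p)" "bilinear (metric N j q)"
    using assms by (auto simp: inner_product_form_def)
  have "bilinear (metric (spin_product M N) (i, j) (p, q))"
    unfolding bilinear_def
    by (auto intro!: linearI simp: algebra_simps bilinear_ladd[OF b(1)] bilinear_radd[OF b(1)]
        bilinear_lmul[OF b(1)] bilinear_rmul[OF b(1)] bilinear_ladd[OF b(2)] bilinear_radd[OF b(2)]
        bilinear_lmul[OF b(2)] bilinear_rmul[OF b(2)])
  moreover have "metric M i p v v > 0 \<or> v = 0" "metric N j q w w > 0 \<or> w = 0" for v w
    using assms by (auto simp: inner_product_form_def)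
  then have "metric M i p v v + metric N j q w w > 0" if "(v, w) \<noteq> 0" for v w
    using that bilinear_lzero[OF b(1)] bilinear_lzero[OF b(2)]
    by (metis add.left_neutral add.right_neutral add_pos_pos zero_prod_def)
  moreover have "metric M i p v w = metric M i p w v" "metric N j q x y = metric N j q y x" for v w x y
    using assms by (auto simp: inner_product_form_def)
  ultimately show ?thesis
    unfolding inner_product_form_def by (metis spin_product_simps(5) surj_pair)
qed

text \<open>
  Christoffel symbols and spin derivatives at a point are computed in one chart; these are the facts
  about that chart.
\<close>

lemma spin_manifold_local:
  assumes "spin_manifold M" "i \<in> index M"
  shows "coordinate_chart M i"
    and "p \<in> chart_dom M i \<Longrightarrow> inner_product_form (metric M i p)"
    and "smooth_in_chart M i (chart_dom M i) (\<lambda>p. metric M i p v w)"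
    and "smooth_in_chart M i (chart_dom M i) (\<lambda>p. frame M i p a)"
    and "p \<in> chart_dom M i \<Longrightarrow> linear (frame M i p)"
    and "p \<in> chart_dom M i \<Longrightarrow>
      metric_connection (\<lambda>u v w. chart_deriv M i (\<lambda>q. metric M i q v w) p u) (metric M i p)
        (christoffel M i p)"
    and "linear (cliff M)" and "spinor_module (cliff M)"
proof -
  have R: "riemannian_manifold M" and "smooth_manifold M"
    using assms by (auto simp: spin_manifold_def riemannian_manifold_def)
  then show "coordinate_chart M i" "smooth_in_chart M i (chart_dom M i) (\<lambda>p. metric M i p v w)"
    "p \<in> chart_dom M i \<Longrightarrow> inner_product_form (metric M i p)"
    "p \<in> chart_dom M i \<Longrightarrow>
      metric_connection (\<lambda>u v w. chart_deriv M i (\<lambda>q. metric M i q v w) p u) (metric M i p)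
        (christoffel M i p)"
    using assms(2) smooth_manifold_coordinate_chart
      riemannian_inner_product_form[OF R] christoffel_metric_connection[OF R]
    by (auto simp: riemannian_manifold_def)
qed (use assms in \<open>auto simp: spin_manifold_def spinor_module_def\<close>)

text \<open>
  The product metric is the sum of a function on each factor, so the pair of Christoffel symbols is
  torsion-free and metric; uniqueness identifies it with the Christoffel symbols of the product.
\<close>

lemma christoffel_spin_product:
  assumes M: "spin_manifold M" "i \<in> index M" "p \<in> chart_dom M i"
    and N: "spin_manifold N" "j \<in> index N" "q \<in> chart_dom N j"
  shows "christoffel (spin_product M N) (i, j) (p, q) (v, w) (v', w') =
    (christoffel M i p v v', christoffel N j q w w')"
proof -
  let ?\<Gamma> = "\<lambda>(v, w) (v', w'). (christoffel M i p v v', christoffel N j q w w')"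
  have cM: "metric_connection (\<lambda>u v w. chart_deriv M i (\<lambda>q. metric M i q v w) p u)
      (metric M i p) (christoffel M i p)"
    and cN: "metric_connection (\<lambda>u v w. chart_deriv N j (\<lambda>q. metric N j q v w) q u)
      (metric N j q) (christoffel N j q)"
    using spin_manifold_local(6)[OF M(1,2,3)] spin_manifold_local(6)[OF N(1,2,3)] .
  then have b: "bilinear (christoffel M i p)" "bilinear (christoffel N j q)"
    by (auto simp: metric_connection_def)
  have "chart_deriv (spin_product M N) (i, j)
      (\<lambda>z. metric (spin_product M N) (i, j) z (v, w) (v', w')) (p, q) =
      (\<lambda>(u, u'). chart_deriv M i (\<lambda>q. metric M i q v v') p u +
        chart_deriv N j (\<lambda>p. metric N j p w w') q u')" for v w v' w'
  proof -
    have "((\<lambda>z. fst z + snd z) has_derivative (\<lambda>z. fst z + snd z))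
        (at (metric M i p v v', metric N j q w w'))"
      by (intro derivative_intros)
    from chart_deriv_spin_product[OF spin_manifold_local(1)[OF M(1,2)] M(3)
        spin_manifold_local(1)[OF N(1,2)] N(3)
        chart_deriv_has_derivative[OF spin_manifold_local(3)[OF M(1,2)] M(3)]
        chart_deriv_has_derivative[OF spin_manifold_local(3)[OF N(1,2)] N(3)] this]
    show ?thesis by simp
  qed
  then have "metric_connection
      (\<lambda>u v w. chart_deriv (spin_product M N) (i, j)
        (\<lambda>z. metric (spin_product M N) (i, j) z v w) (p, q) u)
      (metric (spin_product M N) (i, j) (p, q)) ?\<Gamma>"
    using cM cN unfolding metric_connection_def bilinear_def
    by (auto intro!: linearI simp: bilinear_ladd[OF b(1)] bilinear_radd[OF b(1)]
        bilinear_lmul[OF b(1)] bilinear_rmul[OF b(1)] bilinear_ladd[OF b(2)] bilinear_radd[OF b(2)]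
        bilinear_lmul[OF b(2)] bilinear_rmul[OF b(2)])
  from christoffel_eqI[OF inner_product_form_spin_product[where M = M and N = N,
        OF spin_manifold_local(2)[OF M] spin_manifold_local(2)[OF N]] this]
  show ?thesis by simp
qed

lemma levi_civita_spin_product:
  assumes M: "spin_manifold M" "i \<in> index M" "p \<in> chart_dom M i"
    and N: "spin_manifold N" "j \<in> index N" "q \<in> chart_dom N j"
  shows "levi_civita (spin_product M N) (i, j) (\<lambda>z. frame (spin_product M N) (i, j) z (a, b)) (p, q) (v, w) =
    (levi_civita M i (\<lambda>z. frame M i z a) p v, levi_civita N j (\<lambda>z. frame N j z b) q w)"
proof -
  have "chart_deriv (spin_product M N) (i, j) (\<lambda>z. frame (spin_product M N) (i, j) z (a, b)) (p, q) =
      (\<lambda>(v, w). (chart_deriv M i (\<lambda>z. frame M i z a) p v, chart_deriv N j (\<lambda>z. frame N j z b) q w))"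
    by (rule chart_deriv_spin_product[OF spin_manifold_local(1)[OF M(1,2)] M(3)
          spin_manifold_local(1)[OF N(1,2)] N(3)
          chart_deriv_has_derivative[OF spin_manifold_local(4)[OF M(1,2)] M(3)]
          chart_deriv_has_derivative[OF spin_manifold_local(4)[OF N(1,2)] N(3)]
          has_derivative_ident]) simp
  then show ?thesis
    by (simp add: levi_civita_def christoffel_spin_product[OF M N])
qed

text \<open>
  The first equation makes the mixed terms of the product spin connection vanish: there the frame of
  one factor is evaluated at the zero vector.
\<close>

lemma levi_civita_zero:
  assumes M: "spin_manifold M" "i \<in> index M" "p \<in> chart_dom M i"
  shows "levi_civita M i (\<lambda>z. frame M i z 0) p v = 0" "levi_civita M i (\<lambda>z. frame M i z a) p 0 = 0"
proof -
  have b: "bilinear (christoffel M i p)"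
    using spin_manifold_local(6)[OF M] by (simp add: metric_connection_def)
  have z: "frame M i z 0 = 0" if "z \<in> chart_dom M i" for z
    using linear_0[OF spin_manifold_local(5)[OF M(1,2) that]] .
  have "chart_deriv M i (\<lambda>z. frame M i z 0) p = (\<lambda>_. 0)"
    by (rule chart_deriv_eqI[OF spin_manifold_local(1)[OF M(1,2)] M(3) has_derivative_const z])
  then show "levi_civita M i (\<lambda>z. frame M i z 0) p v = 0"
    by (simp add: levi_civita_def z[OF M(3)] bilinear_rzero[OF b])
  show "levi_civita M i (\<lambda>z. frame M i z a) p 0 = 0"
    using linear_0[OF has_derivative_linear[OF
          chart_deriv_has_derivative[OF spin_manifold_local(4)[OF M(1,2)] M(3)]]]
    by (simp add: levi_civita_def bilinear_lzero[OF b])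
qed

lemma cliff_spin_product_tensor:
  "cliff (spin_product M N) (x, y) *v tensor s t =
     tensor (cliff M x *v s) t + tensor (volume_element (cliff M) *v s) (cliff N y *v t)"
  by (simp add: matrix_vector_mult_add_rdistrib kronecker_tensor)

text \<open>
  The double sum in the spin connection splits into four blocks. The mixed blocks vanish, as the
  frame field \<open>(e\<^sub>a, 0)\<close> has derivatives tangent to the first factor only. In the block of the second
  factor each of the two Clifford multiplications brings a volume element of the first factor, and
  these cancel because the volume element squares to the identity.
\<close>

lemma spin_deriv_tensor:
  assumes M: "spin_manifold M" "i \<in> index M" "p \<in> chart_dom M i" and even: "even (DIM('a))"
    and N: "spin_manifold N" "j \<in> index N" "q \<in> chart_dom N j"
    and f: "smooth_in_chart M i (chart_dom M i) (\<phi> i)"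
    and g: "smooth_in_chart N j (chart_dom N j) (\<psi> j)"
  shows "spin_deriv (spin_product (M :: ('p, 'i, 'a::euclidean_space, 's::finite) spin) N)
      (\<lambda>(i, j) (p, q). tensor (\<phi> i p) (\<psi> j q)) (i, j) (p, q) (v, w) =
    tensor (spin_deriv M \<phi> i p v) (\<psi> j q) + tensor (\<phi> i p) (spin_deriv N \<psi> j q w)"
proof -
  interpret tensor: bounded_bilinear tensor by (rule bounded_bilinear_tensor)
  have "((\<lambda>z. tensor (fst z) (snd z)) has_derivative
      (\<lambda>h. tensor (\<phi> i p) (snd h) + tensor (fst h) (\<psi> j q))) (at (\<phi> i p, \<psi> j q))"
    using tensor.FDERIV[OF has_derivative_fst[OF has_derivative_ident]
        has_derivative_snd[OF has_derivative_ident], of "(\<phi> i p, \<psi> j q)"] by simp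
  from chart_deriv_spin_product[OF spin_manifold_local(1)[OF M(1,2)] M(3)
        spin_manifold_local(1)[OF N(1,2)] N(3)
        chart_deriv_has_derivative[OF f M(3)] chart_deriv_has_derivative[OF g N(3)] this]
  have der: "chart_deriv (spin_product M N) (i, j) (\<lambda>(p, q). tensor (\<phi> i p) (\<psi> j q)) (p, q) (v, w) =
      tensor (\<phi> i p) (chart_deriv N j (\<psi> j) q w) + tensor (chart_deriv M i (\<phi> i) p v) (\<psi> j q)"
    by simp
  have frame0: "frame M i p 0 = 0" "frame N j q 0 = 0"
    using linear_0[OF spin_manifold_local(5)[OF M]] linear_0[OF spin_manifold_local(5)[OF N]] .
  have bil: "bilinear (metric M i p)" "bilinear (metric N j q)"
    using spin_manifold_local(2)[OF M] spin_manifold_local(2)[OF N]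
    by (auto simp: inner_product_form_def)
  have cliff0: "cliff M 0 = 0" "cliff N 0 = 0"
    using linear_0[OF spin_manifold_local(7)[OF M(1,2)]] linear_0[OF spin_manifold_local(7)[OF N(1,2)]] .
  have \<omega>: "volume_element (cliff M) *v (volume_element (cliff M) *v s) = s" for s
    using volume_element_square[OF spin_manifold_local(8)[OF M(1,2)] even]
    by (simp add: matrix_vector_mul_assoc)
  note zeros = levi_civita_zero[OF M] levi_civita_zero[OF N] frame0
    bilinear_lzero[OF bil(1)] bilinear_rzero[OF bil(1)]
    bilinear_lzero[OF bil(2)] bilinear_rzero[OF bil(2)]
  show ?thesis
    unfolding spin_deriv_def
    by (simp add: der sum_Basis_prod levi_civita_spin_product[OF M N] zeros
        cliff_spin_product_tensor cliff0 \<omega> tensor.zero_left tensor.zero_right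
        tensor.add_left tensor.add_right tensor.scaleR_left tensor.scaleR_right
        tensor.sum_left tensor.sum_right scaleR_add_right del: spin_product_simps(8))
qed

lemma spin_deriv_zero:
  assumes M: "spin_manifold M" "i \<in> index M" "p \<in> chart_dom M i"
    and f: "smooth_in_chart M i (chart_dom M i) (\<phi> i)"
  shows "spin_deriv M \<phi> i p 0 = 0"
proof -
  have "bilinear (metric M i p)"
    using spin_manifold_local(2)[OF M] by (simp add: inner_product_form_def)
  then show ?thesis
    using linear_0[OF has_derivative_linear[OF chart_deriv_has_derivative[OF f M(3)]]]
    by (simp add: spin_deriv_def levi_civita_zero[OF M] bilinear_lzero)
qed

lemma clifford_mult_tensor:
  assumes M: "spin_manifold M" "i \<in> index M" "p \<in> chart_dom M i"
    and N: "spin_manifold N" "j \<in> index N" "q \<in> chart_dom N j"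
  shows "clifford_mult (spin_product M N) (i, j) (p, q) (v, w) (tensor s t) =
    tensor (clifford_mult M i p v s) t +
    tensor (volume_element (cliff M) *v s) (clifford_mult N j q w t)"
proof -
  have frame0: "frame M i p 0 = 0" "frame N j q 0 = 0"
    using linear_0[OF spin_manifold_local(5)[OF M]] linear_0[OF spin_manifold_local(5)[OF N]] .
  have bil: "bilinear (metric M i p)" "bilinear (metric N j q)"
    using spin_manifold_local(2)[OF M] spin_manifold_local(2)[OF N]
    by (auto simp: inner_product_form_def)
  have "(\<Sum>b\<in>Basis. metric (spin_product M N) (i, j) (p, q) (v, w)
        (frame (spin_product M N) (i, j) (p, q) b) *\<^sub>R b) =
      (\<Sum>b\<in>Basis. metric M i p v (frame M i p b) *\<^sub>R b, \<Sum>b\<in>Basis. metric N j q w (frame N j q b) *\<^sub>R b)"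
    by (simp add: sum_Basis_prod frame0 bilinear_rzero[OF bil(1)] bilinear_rzero[OF bil(2)]
        prod_eq_iff fst_sum snd_sum)
  then show ?thesis
    unfolding clifford_mult_def by (simp only: cliff_spin_product_tensor)
qed

lemma clifford_mult_linear:
  fixes M :: "('p, 'i, 'a::euclidean_space, 's::finite) spin"
  assumes M: "spin_manifold M" "i \<in> index M" "p \<in> chart_dom M i"
  shows "linear (\<lambda>v. clifford_mult M i p v s)"
proof -
  have bil: "bilinear (metric M i p)"
    using spin_manifold_local(2)[OF M] by (auto simp: inner_product_form_def)
  have add: "cliff M (x + y) = cliff M x + cliff M y" "cliff M (r *\<^sub>R x) = r *\<^sub>R cliff M x" for x y r
    using spin_manifold_local(7)[OF M(1,2)] by (auto simp: linear_iff)
  interpret action: bounded_bilinear "(*v) :: complex^'s^'s \<Rightarrow> complex^'s \<Rightarrow> complex^'s"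
    by (rule bounded_bilinear_matrix_vector_mult)
  show ?thesis
    unfolding clifford_mult_def
    by (rule linearI)
      (simp_all add: bilinear_ladd[OF bil] bilinear_lmul[OF bil] scaleR_add_left sum.distrib add
        scaleR_sum_right[symmetric] scaleR_scaleR[symmetric] action.add_left action.scaleR_left
        del: scaleR_scaleR)
qed

section \<open>A Killing spinor times a parallel spinor\<close>

lemma smooth_in_chart_tensor:
  assumes M: "coordinate_chart M i" and N: "coordinate_chart N j"
    and f: "smooth_in_chart M i (chart_dom M i) f" and g: "smooth_in_chart N j (chart_dom N j) g"
  shows "smooth_in_chart (spin_product M N) (i, j) (chart_dom (spin_product M N) (i, j))
    (\<lambda>(p, q). tensor (f p) (g q))"
proof -
  have "smooth_on (\<lambda>(x, y). tensor (in_chart M i f x) (in_chart N j g y))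
      (chart M i ` chart_dom M i \<times> chart N j ` chart_dom N j)"
    using assms by (auto simp: smooth_on_def smooth_in_chart_def coordinate_chart_def
        intro!: C_on_bilinear_separate[OF bounded_bilinear_tensor])
  then show ?thesis
    by (subst smooth_in_chart_iff[OF coordinate_chart_spin_product[OF M N],
          where F = "\<lambda>(x, y). tensor (in_chart M i f x) (in_chart N j g y)"])
      (auto simp: in_chart_chart[OF M] in_chart_chart[OF N] spin_product_chart_image)
qed

lemma smooth_in_chart_slice:
  assumes M: "coordinate_chart M i" and N: "coordinate_chart N j" "q \<in> chart_dom N j"
    and L: "bounded_linear L"
    and f: "smooth_in_chart (spin_product M N) (i, j) (chart_dom (spin_product M N) (i, j)) f"
  shows "smooth_in_chart M i (chart_dom M i) (\<lambda>p. L (f (p, q)))"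
proof -
  let ?F = "\<lambda>x. L (in_chart (spin_product M N) (i, j) f (x, chart N j q))"
  have "smooth_on ?F (chart M i ` chart_dom M i)"
    using f M N by (auto simp: smooth_on_def smooth_in_chart_def coordinate_chart_def
        spin_product_chart_image intro!: C_on_slice[OF L, of _ _ "chart N j ` chart_dom N j"])
  moreover have "f (p, q) = in_chart (spin_product M N) (i, j) f (chart M i p, chart N j q)"
    if "p \<in> chart_dom M i" for p
    using in_chart_chart[OF coordinate_chart_spin_product[OF M N(1)], of "(p, q)" f] that N by simp
  ultimately show ?thesis
    using smooth_in_chart_iff[OF M, of "\<lambda>p. L (f (p, q))" ?F] by simp
qed

lemma spin_manifold_transition_smooth:
  "spin_manifold M \<Longrightarrow> i \<in> index M \<Longrightarrow> i' \<in> index M \<Longrightarrow>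
     smooth_in_chart M i (chart_dom M i \<inter> chart_dom M i') (chart M i')"
  by (simp add: spin_manifold_def riemannian_manifold_def smooth_manifold_def)

text \<open>
  The transition maps of the product act separately on the two factors, so the first component of
  the field transforms like a vector field on \<open>M\<close> as long as chart and point of \<open>N\<close> are kept fixed.
\<close>

lemma vector_field_slice:
  assumes M: "spin_manifold M" and N: "spin_manifold N" "j \<in> index N" "q \<in> chart_dom N j"
    and X: "vector_field (spin_product M N) X"
  shows "vector_field M (\<lambda>i p. fst (X (i, j) (p, q)))"
  unfolding vector_field_def
proof (intro conjI ballI)
  fix i assume i: "i \<in> index M"
  have "smooth_in_chart (spin_product M N) (i, j) (chart_dom (spin_product M N) (i, j)) (X (i, j))"
    using X i N by (simp add: vector_field_def)
  then show "smooth_in_chart M i (chart_dom M i) (\<lambda>p. fst (X (i, j) (p, q)))"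
    by (rule smooth_in_chart_slice[OF spin_manifold_local(1)[OF M i]
          spin_manifold_local(1)[OF N(1,2)] N(3) bounded_linear_fst])
next
  fix i i' p assume i: "i \<in> index M" "i' \<in> index M" and p: "p \<in> chart_dom M i \<inter> chart_dom M i'"
  have jj: "smooth_in_chart N j (chart_dom N j) (chart N j)"
    using spin_manifold_transition_smooth[OF N(1,2,2)] by simp
  have "X (i', j) (p, q) = change_coords (spin_product M N) (i, j) (i', j) (p, q) (X (i, j) (p, q))"
  proof -
    have "(i, j) \<in> index (spin_product M N)" "(i', j) \<in> index (spin_product M N)"
      "(p, q) \<in> chart_dom (spin_product M N) (i, j) \<inter> chart_dom (spin_product M N) (i', j)"
      using i p N by simp_all
    then show ?thesis using X unfolding vector_field_def by blast
  qed
  moreover have "chart_deriv (spin_product M N) (i, j) (chart (spin_product M N) (i', j)) (p, q) =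
      (\<lambda>(v, w). (chart_deriv M i (chart M i') p v, chart_deriv N j (chart N j) q w))"
    by (rule chart_deriv_spin_product[OF spin_manifold_local(1)[OF M i(1)] _
          spin_manifold_local(1)[OF N(1,2)] N(3)
          chart_deriv_has_derivative[OF spin_manifold_transition_smooth[OF M i] p]
          chart_deriv_has_derivative[OF jj N(3)] has_derivative_ident])
      (use p in auto)
  ultimately show "fst (X (i', j) (p, q)) = change_coords M i i' p (fst (X (i, j) (p, q)))"
    by (simp add: change_coords_def case_prod_unfold)
qed

locale killing_times_parallel =
  fixes M :: "('p, 'i, 'a::euclidean_space, 's::finite) spin" and N :: "('q, 'j, 'b::euclidean_space, 't::finite) spin"
    and \<phi> :: "'i \<Rightarrow> 'p \<Rightarrow> complex^'s" and \<psi> :: "'j \<Rightarrow> 'q \<Rightarrow> complex^'t" and \<mu> :: real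
  assumes M: "spin_manifold M" and N: "spin_manifold N" and even: "even (DIM('a))"
    and \<phi>: "killing_spinor M \<mu> \<phi>" and \<psi>: "parallel_spinor N \<psi>"
begin

definition \<Psi> :: "'i \<times> 'j \<Rightarrow> 'p \<times> 'q \<Rightarrow> complex^('s \<times> 't)" where
  "\<Psi> = (\<lambda>(i, j) (p, q). tensor (\<phi> i p) (\<psi> j q))"

lemma \<Psi>_simp: "\<Psi> (i, j) (p, q) = tensor (\<phi> i p) (\<psi> j q)"
  by (simp add: \<Psi>_def)

lemma smooth_factors:
  "i \<in> index M \<Longrightarrow> smooth_in_chart M i (chart_dom M i) (\<phi> i)"
  "j \<in> index N \<Longrightarrow> smooth_in_chart N j (chart_dom N j) (\<psi> j)"
  using \<phi> \<psi> by (auto simp: killing_spinor_def eigenspinor_def parallel_spinor_def spinor_field_def)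

lemma spin_deriv_\<Psi>:
  assumes "i \<in> index M" "j \<in> index N" "p \<in> chart_dom M i" "q \<in> chart_dom N j"
  shows "spin_deriv (spin_product M N) \<Psi> (i, j) (p, q) (v, w) =
    tensor (spin_deriv M \<phi> i p v) (\<psi> j q)"
proof -
  interpret tensor: bounded_bilinear tensor by (rule bounded_bilinear_tensor)
  have "spin_deriv N \<psi> j q w = 0"
    using \<psi> assms by (simp add: parallel_spinor_def)
  then show ?thesis
    using spin_deriv_tensor[OF M assms(1,3) even N assms(2,4), of \<phi> \<psi> v w] smooth_factors assms
    by (simp add: \<Psi>_def tensor.zero_right)
qed

text \<open>
  In the sum defining the Dirac operator the vectors \<open>(0, e\<^sub>b)\<close> drop out, since \<open>\<Psi>\<close> is parallel in these
  directions; the vectors \<open>(e\<^sub>a, 0)\<close> reproduce the Dirac operator of \<open>M\<close> on the left tensor factor.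
\<close>

lemma eigenspinor_\<Psi>: "eigenspinor (spin_product M N) \<mu> \<Psi>"
  unfolding eigenspinor_def
proof (intro conjI ballI)
  show "spinor_field (spin_product M N) \<Psi>"
    unfolding spinor_field_def
  proof (intro conjI ballI)
    fix k assume "k \<in> index (spin_product M N)"
    then obtain i j where k: "k = (i, j)" "i \<in> index M" "j \<in> index N" by auto
    have "\<Psi> (i, j) = (\<lambda>(p, q). tensor (\<phi> i p) (\<psi> j q))"
      by (simp add: \<Psi>_def)
    then show "smooth_in_chart (spin_product M N) k (chart_dom (spin_product M N) k) (\<Psi> k)"
      unfolding k(1) using smooth_in_chart_tensor[OF spin_manifold_local(1)[OF M k(2)]
          spin_manifold_local(1)[OF N k(3)] smooth_factors(1)[OF k(2)] smooth_factors(2)[OF k(3)]]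
      by simp
  next
    fix k l z
    assume "k \<in> index (spin_product M N)" "l \<in> index (spin_product M N)"
      "z \<in> chart_dom (spin_product M N) k \<inter> chart_dom (spin_product M N) l"
    then obtain i j i' j' p q where kl: "k = (i, j)" "l = (i', j')" "z = (p, q)"
      and "i \<in> index M" "i' \<in> index M" "j \<in> index N" "j' \<in> index N"
      and "p \<in> chart_dom M i \<inter> chart_dom M i'" "q \<in> chart_dom N j \<inter> chart_dom N j'"
      by (cases k, cases l, cases z) auto
    moreover have "spinor_field M \<phi>" "spinor_field N \<psi>"
      using \<phi> \<psi> by (simp_all add: killing_spinor_def eigenspinor_def parallel_spinor_def)
    ultimately have "\<phi> i p = spin_trans M i i' p *v \<phi> i' p" "\<psi> j q = spin_trans N j j' q *v \<psi> j' q"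
      unfolding spinor_field_def by blast+
    then show "\<Psi> k z = spin_trans (spin_product M N) k l z *v \<Psi> l z"
      unfolding kl \<Psi>_simp spin_product_simps(7) kronecker_tensor by (rule arg_cong2)
  qed
  show "nontrivial_spinor (spin_product M N) \<Psi>"
  proof -
    obtain i p j q where "i \<in> index M" "p \<in> chart_dom M i" "\<phi> i p \<noteq> 0"
      and "j \<in> index N" "q \<in> chart_dom N j" "\<psi> j q \<noteq> 0"
      using \<phi> \<psi> by (auto simp: killing_spinor_def eigenspinor_def parallel_spinor_def nontrivial_spinor_def)
    then show ?thesis
      unfolding nontrivial_spinor_def
      by (intro bexI[of _ "(i, j)"] bexI[of _ "(p, q)"]) (auto simp: \<Psi>_simp tensor_nonzero)
  qed
next
  fix k z assume "k \<in> index (spin_product M N)" "z \<in> chart_dom (spin_product M N) k"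
  then obtain i j p q where k: "k = (i, j)" "z = (p, q)"
    and i: "i \<in> index M" "p \<in> chart_dom M i" and j: "j \<in> index N" "q \<in> chart_dom N j"
    by (cases k, cases z) auto
  interpret tensor: bounded_bilinear tensor by (rule bounded_bilinear_tensor)
  have frame0: "frame M i p 0 = 0" "frame N j q 0 = 0"
    using linear_0[OF spin_manifold_local(5)[OF M i]] linear_0[OF spin_manifold_local(5)[OF N j]] .
  have cm0: "clifford_mult M i p 0 s = 0" "clifford_mult N j q 0 t = 0" for s t
    using linear_0[OF clifford_mult_linear[OF M i]] linear_0[OF clifford_mult_linear[OF N j]] .
  have clifford0: "clifford_mult (spin_product M N) (i, j) (p, q) v 0 = 0" for v
    by (simp add: clifford_mult_def)
  have "dirac (spin_product M N) \<Psi> k z =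
      (\<Sum>b\<in>Basis. tensor (clifford_mult M i p (frame M i p b) (spin_deriv M \<phi> i p (frame M i p b))) (\<psi> j q))"
    unfolding k dirac_def
    by (simp add: sum_Basis_prod frame0 spin_deriv_\<Psi>[OF i(1) j(1) i(2) j(2)]
        clifford_mult_tensor[OF M i N j] cm0 tensor.zero_left tensor.zero_right
        spin_deriv_zero[where \<phi> = \<phi>, OF M i smooth_factors(1)[OF i(1)]] clifford0)
  also have "\<dots> = tensor (dirac M \<phi> i p) (\<psi> j q)"
    by (simp add: dirac_def tensor.sum_left)
  also have "dirac M \<phi> i p = \<mu> *\<^sub>R \<phi> i p"
    using \<phi> i by (simp add: killing_spinor_def eigenspinor_def)
  finally show "dirac (spin_product M N) \<Psi> k z = \<mu> *\<^sub>R \<Psi> k z"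
    by (simp add: k \<Psi>_simp tensor.scaleR_left)
qed

text \<open>
  Clifford multiplication by \<open>(v, w)\<close> involves the volume element through \<open>w\<close> only. Adding the product with
  \<open>(v, - w)\<close> removes this part and doubles the one with \<open>v\<close>, whence the factor \<open>2\<close> in the denominators.
\<close>

lemma killing_equation_\<Psi>:
  assumes X: "vector_field (spin_product M N) X"
    and "k \<in> index (spin_product M N)" "z \<in> chart_dom (spin_product M N) k"
  shows "spin_deriv (spin_product M N) \<Psi> k z (X k z) =
    - (\<mu> / (2 * real DIM('a))) *\<^sub>R clifford_mult (spin_product M N) k z (X k z) (\<Psi> k z)
    - (\<mu> / (2 * real DIM('a))) *\<^sub>R
        clifford_mult (spin_product M N) k z (product_structure (X k z)) (\<Psi> k z)"
proof -
  obtain i j p q where k: "k = (i, j)" "z = (p, q)"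
    and i: "i \<in> index M" "p \<in> chart_dom M i" and j: "j \<in> index N" "q \<in> chart_dom N j"
    using assms by (cases k, cases z) auto
  obtain v w where vw: "X k z = (v, w)" by fastforce
  interpret tensor: bounded_bilinear tensor by (rule bounded_bilinear_tensor)
  have neg: "clifford_mult N j q (- w) t = - clifford_mult N j q w t" for t
    using linear_neg[OF clifford_mult_linear[OF N j]] .
  have "spin_deriv M \<phi> i p v = - (\<mu> / real DIM('a)) *\<^sub>R clifford_mult M i p v (\<phi> i p)"
  proof -
    let ?Y = "\<lambda>i p. fst (X (i, j) (p, q))"
    have "?Y i p = v" using vw k by simp
    then show ?thesis
      using vector_field_slice[OF M N j X] \<phi> i unfolding killing_spinor_def by metis
  qed
  then have "spin_deriv (spin_product M N) \<Psi> k z (X k z) =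
      - (\<mu> / real DIM('a)) *\<^sub>R tensor (clifford_mult M i p v (\<phi> i p)) (\<psi> j q)"
    using spin_deriv_\<Psi>[OF i(1) j(1) i(2) j(2)] vw k by (simp add: tensor.scaleR_left tensor.minus_left)
  \<comment> \<open>\<open>X + \<phi>(X) = 2 (v, 0)\<close> for the product structure \<open>\<phi>\<close>\<close>
  moreover have "clifford_mult (spin_product M N) k z (X k z) (\<Psi> k z) +
      clifford_mult (spin_product M N) k z (product_structure (X k z)) (\<Psi> k z) =
      2 *\<^sub>R tensor (clifford_mult M i p v (\<phi> i p)) (\<psi> j q)"
    unfolding vw unfolding k product_structure_def \<Psi>_simp
    by (simp add: clifford_mult_tensor[OF M i N j] neg tensor.minus_right scaleR_2)
  moreover have "- (c / (2 * n)) *\<^sub>R x - (c / (2 * n)) *\<^sub>R y = - (c / n) *\<^sub>R t"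
    if "x + y = 2 *\<^sub>R t" for c n :: real and x y t :: "complex^('s \<times> 't)"
  proof -
    have "- (c / (2 * n)) *\<^sub>R x - (c / (2 * n)) *\<^sub>R y = - (c / (2 * n)) *\<^sub>R (x + y)"
      by (simp add: scaleR_add_right)
    then show ?thesis by (simp add: that)
  qed
  ultimately show ?thesis by simp
qed

end

lemma killing_times_parallel_solution:
  fixes M :: "('p, 'i, 'a::euclidean_space, 's::finite) spin"
    and N :: "('q, 'j, 'b::euclidean_space, 't::finite) spin"
  assumes "spin_manifold M" "spin_manifold N" "even (DIM('a))"
    and "killing_spinor M \<mu> \<phi>" "parallel_spinor N \<psi>" "\<mu> \<noteq> 0"
  shows "\<exists>\<Psi> \<nu> \<kappa>. eigenspinor (spin_product M N) \<nu> \<Psi> \<and> \<kappa> \<noteq> 0 \<and>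
      (\<forall>X. vector_field (spin_product M N) X \<longrightarrow>
        (\<forall>k\<in>index (spin_product M N). \<forall>p\<in>chart_dom (spin_product M N) k.
          spin_deriv (spin_product M N) \<Psi> k p (X k p) =
            - (\<kappa> / (2 * real DIM('a))) *\<^sub>R clifford_mult (spin_product M N) k p (X k p) (\<Psi> k p)
            - (\<kappa> / (2 * real DIM('a))) *\<^sub>R
                clifford_mult (spin_product M N) k p (product_structure (X k p)) (\<Psi> k p)))"
proof -
  interpret killing_times_parallel M N \<phi> \<psi> \<mu>
    using assms by unfold_locales
  show ?thesis
    using eigenspinor_\<Psi> killing_equation_\<Psi> assms(6) by blast
qed

section \<open>The circle as a flat spin manifold\<close>

lemma spin_circle_simps [simp]:
  "mtop spin_circle = top_of_set (sphere 0 1)"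
  "index spin_circle = UNIV"
  "chart_dom spin_circle t = sphere 0 1 - {- cis t}"
  "chart spin_circle t z = t + Arg (z * cis (- t))"
  "metric spin_circle t z v w = v * w"
  "frame spin_circle t z v = v"
  "spin_trans spin_circle s t z = mat 1"
  "cliff spin_circle v = mat (\<i> * complex_of_real v)"
  by (simp_all add: spin_circle_def)

lemma cis_circle_chart:
  assumes "z \<in> sphere 0 1"
  shows "cis (chart spin_circle t z) = z"
proof -
  have "z \<noteq> 0" "norm (z * cis (- t)) = 1" using assms by (auto simp: norm_mult)
  then have "cis (Arg (z * cis (- t))) = z * cis (- t)"
    by (subst cis_Arg) (auto simp: sgn_div_norm)
  then have "cis (chart spin_circle t z) = z * (cis t * cis (- t))"
    by (simp add: cis_mult[symmetric] mult_ac)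
  then show ?thesis by (simp add: cis_mult)
qed

lemma circle_chart_bounds:
  assumes "z \<in> chart_dom spin_circle t"
  shows "chart spin_circle t z \<in> {t - pi<..<t + pi}"
proof -
  have "Arg (z * cis (- t)) \<noteq> pi"
  proof
    assume "Arg (z * cis (- t)) = pi"
    then have "chart spin_circle t z = t + pi" by simp
    then have "z = cis (t + pi)"
      using cis_circle_chart[of z t] assms by simp
    then show False using assms by (simp add: cis_mult[symmetric])
  qed
  then show ?thesis using Arg_bounded[of "z * cis (- t)"] by auto
qed

lemma circle_chart_cis:
  assumes "x \<in> {t - pi<..<t + pi}"
  shows "chart spin_circle t (cis x) = x" "cis x \<in> chart_dom spin_circle t"
proof -
  show "chart spin_circle t (cis x) = x"
    using assms Arg_cis[of "x - t"] by (auto simp: cis_mult)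
  have "cis (x - t) \<noteq> - 1"
  proof
    assume "cis (x - t) = - 1"
    then have "Arg (cis (x - t)) = pi" by (simp only: Arg_eq_pi) simp
    moreover have "Arg (cis (x - t)) = x - t" using assms by (intro Arg_cis) auto
    ultimately show False using assms by simp
  qed
  moreover have "cis (x - t) = cis x * cis (- t)" by (simp add: cis_mult)
  moreover have "- cis t * cis (- t) = - 1" by (simp add: cis_mult)
  ultimately have "cis x \<noteq> - cis t" by metis
  then show "cis x \<in> chart_dom spin_circle t" by simp
qed

lemma circle_chart_image: "chart spin_circle t ` chart_dom spin_circle t = {t - pi<..<t + pi}"
proof (intro equalityI subsetI)
  fix x assume "x \<in> {t - pi<..<t + pi}"
  then show "x \<in> chart spin_circle t ` chart_dom spin_circle t"
    using circle_chart_cis by (metis imageI)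
qed (use circle_chart_bounds in blast)

lemma coordinate_chart_circle: "coordinate_chart spin_circle t"
proof -
  have "inj_on (chart spin_circle t) (chart_dom spin_circle t)"
    by (rule inj_on_inverseI[of _ cis]) (use cis_circle_chart in auto)
  then show ?thesis
    unfolding coordinate_chart_def circle_chart_image by simp
qed

text \<open>
  The inverse is \<open>cis\<close>. The cut of \<open>Arg\<close> corresponds to the point \<open>- cis t\<close>, which the chart domain omits.
\<close>

lemma homeomorphic_circle_chart:
  "homeomorphic_map (subtopology (mtop spin_circle) (chart_dom spin_circle t))
    (top_of_set (chart spin_circle t ` chart_dom spin_circle t)) (chart spin_circle t)"
proof -
  let ?D = "chart_dom spin_circle t"
  have *: "z * cis (- t) \<notin> \<real>\<^sub>\<le>\<^sub>0" if "z \<in> ?D" for z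
  proof
    assume "z * cis (- t) \<in> \<real>\<^sub>\<le>\<^sub>0"
    moreover have "z * cis (- t) \<noteq> 0" using that by auto
    ultimately have "Arg (z * cis (- t)) = pi"
      by (auto simp: Arg_eq_pi complex_nonpos_Reals_iff complex_eq_iff)
    then show False using circle_chart_bounds[OF that] by simp
  qed
  have inverse: "cis (chart spin_circle t z) = z" if "z \<in> ?D" for z
    using cis_circle_chart[of z t] that by simp
  from * have "continuous_on ?D (\<lambda>z. t + Arg (z * cis (- t)))"
    by (intro continuous_intros) auto
  then have "continuous_on ?D (chart spin_circle t)"
    by simp
  moreover have "continuous_on {t - pi<..<t + pi} cis"
    by (intro continuous_intros)
  moreover have "subtopology (mtop spin_circle) ?D = top_of_set ?D"
    by (simp add: subtopology_subtopology inf_absorb2)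
  ultimately have "homeomorphic_maps (subtopology (mtop spin_circle) ?D)
      (top_of_set {t - pi<..<t + pi}) (chart spin_circle t) cis"
    using circle_chart_bounds circle_chart_cis inverse
    by (auto simp: homeomorphic_maps_def simp del: spin_circle_simps(3,4))
  then show ?thesis
    unfolding circle_chart_image homeomorphic_map_maps by blast
qed

text \<open>
  Two angle functions differ by a locally constant multiple of \<open>2 * pi\<close>. The multiple need not be
  named: if the angles of \<open>z\<close> are \<open>x0\<close> and \<open>y\<close>, the second angle function is \<open>x \<mapsto> y + (x - x0)\<close> near \<open>x0\<close>,
  because \<open>cis\<close> takes the same values there and the right-hand side stays in the range of the chart.
\<close>

lemma circle_transition_has_derivative:
  assumes "z \<in> chart_dom spin_circle s \<inter> chart_dom spin_circle t"
  shows "((\<lambda>x. chart spin_circle t (cis x)) has_derivative (\<lambda>v. v)) (at (chart spin_circle s z))"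
proof -
  define x0 where "x0 = chart spin_circle s z"
  define y where "y = chart spin_circle t z"
  have y: "cis y = cis x0" "y \<in> {t - pi<..<t + pi}"
    using assms cis_circle_chart[of z] circle_chart_bounds[of z t] unfolding x0_def y_def by auto
  let ?U = "{x. y + (x - x0) \<in> {t - pi<..<t + pi}}"
  have "((\<lambda>x. y + (x - x0)) has_derivative (\<lambda>v. v)) (at x0)"
    by (auto intro!: derivative_eq_intros)
  then show ?thesis
    unfolding x0_def[symmetric]
  proof (rule has_derivative_transform_within_open)
    have "?U = {t - pi - y + x0<..<t + pi - y + x0}" by auto
    then show "open ?U" by simp
    show "x0 \<in> ?U" using y by simp
    fix x assume x: "x \<in> ?U"
    have "cis x = cis x0 * cis (x - x0)" by (simp add: cis_mult)
    also have "\<dots> = cis (y + (x - x0))" by (simp add: cis_mult y(1)[symmetric])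
    finally show "y + (x - x0) = chart spin_circle t (cis x)"
      using circle_chart_cis(1) x by (metis mem_Collect_eq)
  qed
qed

lemma circle_change_coords:
  assumes "z \<in> chart_dom spin_circle s \<inter> chart_dom spin_circle t"
  shows "change_coords spin_circle s t z v = v"
proof -
  have "chart_deriv spin_circle s (chart spin_circle t) z = (\<lambda>v. v)"
    by (rule chart_deriv_eqI[OF coordinate_chart_circle _ circle_transition_has_derivative])
      (use assms in \<open>auto simp: cis_circle_chart simp del: spin_circle_simps(4)\<close>)
  then show ?thesis by (simp add: change_coords_def)
qed

lemma circle_overlap_open:
  "open (chart spin_circle s ` (chart_dom spin_circle s \<inter> chart_dom spin_circle t))"
proof -
  have "chart spin_circle s ` (chart_dom spin_circle s \<inter> chart_dom spin_circle t) =
      {s - pi<..<s + pi} \<inter> cis -` (- {- cis t})"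
  proof (intro equalityI subsetI)
    fix x assume "x \<in> {s - pi<..<s + pi} \<inter> cis -` (- {- cis t})"
    then have "x = chart spin_circle s (cis x)"
      "cis x \<in> chart_dom spin_circle s \<inter> chart_dom spin_circle t"
      using circle_chart_cis[of x s] by auto
    then show "x \<in> chart spin_circle s ` (chart_dom spin_circle s \<inter> chart_dom spin_circle t)"
      by blast
  qed (use circle_chart_bounds cis_circle_chart in \<open>auto simp del: spin_circle_simps(4)\<close>)
  moreover have "open (cis -` (- {- cis t}))"
    by (intro open_vimage continuous_intros)
  ultimately show ?thesis by auto
qed

lemma circle_smooth_const:
  "smooth_in_chart spin_circle s (chart_dom spin_circle s \<inter> chart_dom spin_circle t) (\<lambda>_. c)"
  "smooth_in_chart spin_circle s (chart_dom spin_circle s) (\<lambda>_. c)"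
proof -
  show *: "smooth_in_chart spin_circle s (chart_dom spin_circle s \<inter> chart_dom spin_circle t) (\<lambda>_. c)" for t
    unfolding smooth_in_chart_def in_chart_def
    by (rule smooth_on_constant_derivative[OF circle_overlap_open has_derivative_const])
  show "smooth_in_chart spin_circle s (chart_dom spin_circle s) (\<lambda>_. c)"
    using *[of s] by simp
qed

lemma circle_transition_smooth:
  "smooth_in_chart spin_circle s (chart_dom spin_circle s \<inter> chart_dom spin_circle t) (chart spin_circle t)"
  unfolding smooth_in_chart_def
proof (rule smooth_on_cong[OF circle_overlap_open])
  show "smooth_on (\<lambda>x. chart spin_circle t (cis x))
      (chart spin_circle s ` (chart_dom spin_circle s \<inter> chart_dom spin_circle t))"
    by (rule smooth_on_constant_derivative[OF circle_overlap_open])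
      (use circle_transition_has_derivative in blast)
  fix x assume "x \<in> chart spin_circle s ` (chart_dom spin_circle s \<inter> chart_dom spin_circle t)"
  then obtain z where z: "z \<in> chart_dom spin_circle s" "x = chart spin_circle s z" by blast
  then show "chart spin_circle t (cis x) = in_chart spin_circle s (chart spin_circle t) x"
    using in_chart_chart[OF coordinate_chart_circle z(1), of "chart spin_circle t"]
      cis_circle_chart[of z s] by simp
qed

lemma second_countable_euclidean: "second_countable (euclidean :: 'a::second_countable_topology topology)"
proof -
  obtain B :: "'a set set" where "countable B" "topological_basis B"
    using ex_countable_basis by blast
  then show ?thesis
    unfolding second_countable_def
    by (metis open_openin topological_basisE topological_basis_open)
qed

lemma riemannian_manifold_circle: "riemannian_manifold spin_circle"
proof -
  have "smooth_manifold spin_circle"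
    unfolding smooth_manifold_def
  proof (intro conjI ballI)
    show "Hausdorff_space (mtop spin_circle)"
      by (simp add: Hausdorff_space_subtopology)
    show "second_countable (mtop spin_circle)"
      by (simp add: second_countable_subtopology second_countable_euclidean)
    \<comment> \<open>each point lies in the chart centred at it; the chart at \<open>0\<close> yields an angle of it\<close>
    have "z \<in> chart_dom spin_circle (chart spin_circle 0 z)" if "z \<in> sphere 0 1" for z
    proof -
      have "cis c \<in> chart_dom spin_circle c" for c by (rule circle_chart_cis(2)) simp
      then show ?thesis using cis_circle_chart[OF that, of 0] by metis
    qed
    then show "(\<Union>i\<in>index spin_circle. chart_dom spin_circle i) = topspace (mtop spin_circle)"
      by fastforce
    fix t
    show "openin (mtop spin_circle) (chart_dom spin_circle t)"
      by (auto simp: openin_open intro!: exI[of _ "- {- cis t}"])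
    show "open (chart spin_circle t ` chart_dom spin_circle t)"
      unfolding circle_chart_image by simp
  qed (rule homeomorphic_circle_chart circle_transition_smooth)+
  moreover have "bilinear (metric spin_circle t z)" for t z
    unfolding bilinear_def by (auto intro!: linearI simp: algebra_simps)
  moreover have "smooth_in_chart spin_circle t (chart_dom spin_circle t) (\<lambda>p. metric spin_circle t p v w)" for t v w
    unfolding spin_circle_simps(5) by (rule circle_smooth_const)
  ultimately show ?thesis
    unfolding riemannian_manifold_def
    by (auto simp: circle_change_coords zero_less_mult_iff simp del: spin_circle_simps(3) )
qed

lemma spin_manifold_circle: "spin_manifold spin_circle"
proof -
  have "spinor_module (cliff spin_circle)"
  proof -
    have m: "mat z ** mat w = (mat (z * w) :: complex^1^1)" "mat z + mat w = (mat (z + w) :: complex^1^1)"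
      "r *\<^sub>R mat z = (mat (r *\<^sub>R z) :: complex^1^1)" for z w r
      by (simp_all add: vec_eq_iff matrix_matrix_mult_def mat_def)
    have "linear (cliff spin_circle)"
      by (rule linearI) (simp_all add: m algebra_simps scaleR_conv_of_real[where 'a = complex])
    then show ?thesis
      by (simp add: spinor_module_def m algebra_simps)
  qed
  moreover have "mat 1 \<in> spin_group (cliff spin_circle)"
    by (auto simp: spin_group_def intro!: exI[of _ "[]"])
  moreover have "smooth_in_chart spin_circle t (chart_dom spin_circle t) (\<lambda>p. frame spin_circle t p v)" for t v
    unfolding spin_circle_simps(6) by (rule circle_smooth_const)
  moreover have "smooth_in_chart spin_circle s (chart_dom spin_circle s \<inter> chart_dom spin_circle t)
      (spin_trans spin_circle s t)" for s t
  proof -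
    have "spin_trans spin_circle s t = (\<lambda>_. mat 1)" by auto
    then show ?thesis using circle_smooth_const(1) by simp
  qed
  moreover have "linear (frame spin_circle t p)" for t p
    by (rule linearI) auto
  ultimately show ?thesis
    unfolding spin_manifold_def using riemannian_manifold_circle
    by (auto simp: circle_change_coords simp del: spin_circle_simps(3,8))
qed

text \<open>
  Metric and frame are constant in the angle charts, so the Christoffel symbols and the spin
  connection vanish; the trivial cocycle makes the constant spinor a global section.
\<close>

lemma parallel_spinor_circle: "parallel_spinor spin_circle (\<lambda>_ _. 1)"
proof -
  have dconst: "chart_deriv spin_circle t (\<lambda>_. c) p = (\<lambda>_. 0)" if "p \<in> chart_dom spin_circle t" for t p c
    by (rule chart_deriv_eqI[OF coordinate_chart_circle that has_derivative_const refl])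
  have chr: "christoffel spin_circle t p = (\<lambda>_ _. 0)" if p: "p \<in> chart_dom spin_circle t" for t p
  proof (rule christoffel_eqI)
    show "inner_product_form (metric spin_circle t p)"
      using riemannian_inner_product_form[OF riemannian_manifold_circle _ p] by simp
    have "bilinear (\<lambda>(_ :: real) (_ :: real). 0 :: real)" by (auto simp: bilinear_def intro!: linearI)
    then show "metric_connection (\<lambda>u v w. chart_deriv spin_circle t (\<lambda>q. metric spin_circle t q v w) p u)
        (metric spin_circle t p) (\<lambda>_ _. 0)"
      by (simp add: metric_connection_def dconst[OF p] del: spin_circle_simps(3))
  qed
  have "spin_deriv spin_circle (\<lambda>_ _. 1) t p v = 0" if p: "p \<in> chart_dom spin_circle t" for t p v
    by (simp add: spin_deriv_def levi_civita_def dconst[OF p] chr[OF p] del: spin_circle_simps(3))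
  moreover have "spinor_field spin_circle (\<lambda>_ _. 1)"
    unfolding spinor_field_def by (simp add: circle_smooth_const(2) del: spin_circle_simps(3))
  moreover have "nontrivial_spinor spin_circle (\<lambda>_ _. 1)"
    unfolding nontrivial_spinor_def
    by (intro bexI[of _ 0] bexI[of _ "cis 0"]) auto
  ultimately show ?thesis
    unfolding parallel_spinor_def by blast
qed

theorem theorem4p2:
  fixes M1 :: "('p, 'i, 'a::euclidean_space, 's::finite) spin"
    and \<psi>1 :: "'i \<Rightarrow> 'p \<Rightarrow> complex^'s"
    and lambda1 :: real
    and m n1 :: nat
  assumes "spin_manifold M1"
    and "DIM('a) = 2 * m" and "m \<ge> 1" and "n1 = 2 * m"
    and "killing_spinor M1 lambda1 \<psi>1" and "lambda1 \<noteq> 0"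
  shows "(\<forall>(M2 :: ('q, 'j, 'b::euclidean_space, 't::finite) spin) \<psi>2 r.
      spin_manifold M2 \<and> DIM('b) = r \<and> 2 * m > r \<and> r \<ge> 2 \<and> parallel_spinor M2 \<psi>2 \<longrightarrow>
      (\<exists>\<psi> \<mu> lambda'. eigenspinor (spin_product M1 M2) \<mu> \<psi> \<and> lambda' \<noteq> 0 \<and>
        (\<forall>X. vector_field (spin_product M1 M2) X \<longrightarrow>
          (\<forall>k\<in>index (spin_product M1 M2). \<forall>p\<in>chart_dom (spin_product M1 M2) k.
            spin_deriv (spin_product M1 M2) \<psi> k p (X k p) =
              - (lambda' / (2 * real n1)) *\<^sub>R clifford_mult (spin_product M1 M2) k p (X k p) (\<psi> k p)
              - (lambda' / (2 * real n1)) *\<^sub>R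
                  clifford_mult (spin_product M1 M2) k p (product_structure (X k p)) (\<psi> k p))))) \<and>
      (\<exists>\<psi> \<mu> lambda'. eigenspinor (spin_product M1 spin_circle) \<mu> \<psi> \<and> lambda' \<noteq> 0 \<and>
        (\<forall>X. vector_field (spin_product M1 spin_circle) X \<longrightarrow>
          (\<forall>k\<in>index (spin_product M1 spin_circle). \<forall>p\<in>chart_dom (spin_product M1 spin_circle) k.
            spin_deriv (spin_product M1 spin_circle) \<psi> k p (X k p) =
              - (lambda' / (2 * real n1)) *\<^sub>R
                  clifford_mult (spin_product M1 spin_circle) k p (X k p) (\<psi> k p)
              - (lambda' / (2 * real n1)) *\<^sub>R
                  clifford_mult (spin_product M1 spin_circle) k p (product_structure (X k p)) (\<psi> k p))))"
proof -
  have even: "even (DIM('a))" and n1: "n1 = DIM('a)"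
    using assms by auto
  note solution = killing_times_parallel_solution[OF assms(1) _ even assms(5) _ assms(6)]
  show ?thesis
    unfolding n1
    using solution solution[OF spin_manifold_circle parallel_spinor_circle] by blast
qed

end
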